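(* Let $\lambda_1,\dots,\lambda_q$ be distinct non-zero real numbers, and let $e_1,\dots,e_q$ be $q$ distinct orthonormal functions of $L^2(0,1)$ such that $e_m\in\mathcal{C}^\alpha([0,1])$ for some $\alpha\in(0,1]$. Let $$K_q(x,y)=\sum_{m=1}^q\lambda_me_m(x)e_m(y),\qquad a_{i,j}(n)=\frac1nK_q\Big(\frac in,\frac jn\Big),\quad 1\le i,j\le n,$$ and let $(Z_i)_{i\ge1}$ be i.i.d. standard normal random variables. Set $$\tilde a_{i,j}(n)=\frac{a_{i,j}(n)}{\big(\sum_{i,j=1}^na_{i,j}(n)^2\big)^{1/2}},\quad \tilde\lambda_m=\frac{\lambda_m}{\big(\sum_{l=1}^q\lambda_l^2\big)^{1/2}},\quad \tilde Q_n(Z)=\sum_{i,j=1}^n\tilde a_{i,j}(n)Z_iZ_j,\quad \tilde Q_\infty=\sum_{m=1}^q\tilde\lambda_m(Z_m^2-1).$$ Then, for $n$ large enough, $$\mathbf{W}_2\big(\tilde Q_n(Z)-\mathbb{E}[\tilde Q_n(Z)],\tilde Q_\infty\big)=\mathcal{O}\Big(\frac1{n^{\alpha/2}}\Big).$$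
   Context: $\mathbf{W}_2(F,G)=(\inf \mathbb{E}|X-Y|^2)^{1/2}$, the infimum being over all couplings $(X,Y)$ with $X\sim F$, $Y\sim G$ in law. $\mathcal{C}^\alpha([0,1])$ is the space of real-valued functions on $[0,1]$ that are Hölder continuous of order $\alpha$. *)

theory Defs
  imports "HOL-Probability.Probability"
begin

section \<open>The quadratic Wasserstein distance on the real line\<close>

text \<open>
  A coupling \<open>(X, Y)\<close> of \<open>F\<close> and \<open>G\<close> is represented by its joint law on the plane, since one
  cannot quantify over all probability spaces inside a formula.
\<close>

definition couplings :: "real measure \<Rightarrow> real measure \<Rightarrow> (real \<times> real) measure set" where
  "couplings F G = {\<gamma>. prob_space \<gamma> \<and> sets \<gamma> = sets borel \<and>
     distr \<gamma> borel fst = F \<and> distr \<gamma> borel snd = G}"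

text \<open>
  The costs are nonnegative integrals, so that a coupling with non-integrable cost has cost
  \<open>\<top>\<close> rather than the default value \<open>0\<close> of the Bochner integral. There is no square root on
  \<^typ>\<open>ennreal\<close>, hence the case distinction in \<open>W2\<close>.
\<close>

definition W2_squared :: "real measure \<Rightarrow> real measure \<Rightarrow> ennreal" where
  "W2_squared F G = (INF \<gamma>\<in>couplings F G. \<integral>\<^sup>+ (x, y). ennreal (\<bar>x - y\<bar>\<^sup>2) \<partial>\<gamma>)"

definition W2 :: "real measure \<Rightarrow> real measure \<Rightarrow> ennreal" where
  "W2 F G = (if W2_squared F G = \<top> then \<top> else ennreal (sqrt (enn2real (W2_squared F G))))"

section \<open>Function spaces\<close>

definition holder_on :: "real \<Rightarrow> real set \<Rightarrow> (real \<Rightarrow> real) \<Rightarrow> bool" where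
  "holder_on \<alpha> S f \<longleftrightarrow> (\<exists>C. \<forall>x\<in>S. \<forall>y\<in>S. \<bar>f x - f y\<bar> \<le> C * \<bar>x - y\<bar> powr \<alpha>)"

definition L2_01 :: "(real \<Rightarrow> real) set" where
  "L2_01 = {f. set_borel_measurable lborel {0<..<1} f \<and>
     set_integrable lborel {0<..<1} (\<lambda>x. (f x)\<^sup>2)}"

definition orthonormal_L2_01 :: "nat set \<Rightarrow> (nat \<Rightarrow> real \<Rightarrow> real) \<Rightarrow> bool" where
  "orthonormal_L2_01 I e \<longleftrightarrow> (\<forall>m\<in>I. e m \<in> L2_01) \<and>
     (\<forall>m\<in>I. \<forall>l\<in>I. (LINT x:{0<..<1}|lborel. e m x * e l x) = (if m = l then 1 else 0))"

section \<open>The quadratic forms\<close>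

definition kernel :: "nat \<Rightarrow> (nat \<Rightarrow> real) \<Rightarrow> (nat \<Rightarrow> real \<Rightarrow> real) \<Rightarrow> real \<Rightarrow> real \<Rightarrow> real" where
  "kernel q lam e x y = (\<Sum>m=1..q. lam m * e m x * e m y)"

definition coef ::
  "nat \<Rightarrow> (nat \<Rightarrow> real) \<Rightarrow> (nat \<Rightarrow> real \<Rightarrow> real) \<Rightarrow> nat \<Rightarrow> nat \<Rightarrow> nat \<Rightarrow> real" where
  "coef q lam e n i j = 1 / real n * kernel q lam e (real i / real n) (real j / real n)"

text \<open>
  If all coefficients of order \<open>n\<close> vanish, the normalised ones are \<open>0\<close>, by division by zero.
  For orthonormal Hoelder functions this concerns only finitely many \<open>n\<close>, because the sum of the
  squared coefficients then tends to the (positive) sum of the \<open>(lam m)\<^sup>2\<close>.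
\<close>

definition coef_normalised ::
  "nat \<Rightarrow> (nat \<Rightarrow> real) \<Rightarrow> (nat \<Rightarrow> real \<Rightarrow> real) \<Rightarrow> nat \<Rightarrow> nat \<Rightarrow> nat \<Rightarrow> real" where
  "coef_normalised q lam e n i j =
     coef q lam e n i j / sqrt (\<Sum>k=1..n. \<Sum>l=1..n. (coef q lam e n k l)\<^sup>2)"

definition lambda_normalised :: "nat \<Rightarrow> (nat \<Rightarrow> real) \<Rightarrow> nat \<Rightarrow> real" where
  "lambda_normalised q lam m = lam m / sqrt (\<Sum>l=1..q. (lam l)\<^sup>2)"

definition Q_n ::
  "nat \<Rightarrow> (nat \<Rightarrow> real) \<Rightarrow> (nat \<Rightarrow> real \<Rightarrow> real) \<Rightarrow> (nat \<Rightarrow> 'a \<Rightarrow> real) \<Rightarrow> nat \<Rightarrow> 'a \<Rightarrow> real" where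
  "Q_n q lam e Z n \<omega> = (\<Sum>i=1..n. \<Sum>j=1..n. coef_normalised q lam e n i j * Z i \<omega> * Z j \<omega>)"

definition Q_n_centred ::
  "'a measure \<Rightarrow> nat \<Rightarrow> (nat \<Rightarrow> real) \<Rightarrow> (nat \<Rightarrow> real \<Rightarrow> real) \<Rightarrow> (nat \<Rightarrow> 'a \<Rightarrow> real) \<Rightarrow> nat \<Rightarrow> 'a \<Rightarrow> real"
where
  "Q_n_centred M q lam e Z n \<omega> =
     Q_n q lam e Z n \<omega> - prob_space.expectation M (Q_n q lam e Z n)"

definition Q_infinity :: "nat \<Rightarrow> (nat \<Rightarrow> real) \<Rightarrow> (nat \<Rightarrow> 'a \<Rightarrow> real) \<Rightarrow> 'a \<Rightarrow> real" where
  "Q_infinity q lam Z \<omega> = (\<Sum>m=1..q. lambda_normalised q lam m * ((Z m \<omega>)\<^sup>2 - 1))"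

end

theory Submission
  imports Defs
begin

text \<open>
  Put \<open>v\<^sub>m = (e m (i / n) / sqrt n)\<close>, for \<open>i = 1, \<dots>, n\<close>. The quadratic form of order \<open>n\<close> is
  \<open>\<Sum>m. (lam m / \<sigma>\<^sub>n) * \<langle>v\<^sub>m, Z\<rangle>\<^sup>2\<close>, where \<open>\<sigma>\<^sub>n\<close> is the Frobenius norm of the coefficient matrix. It
  would have the limit law up to centring if the vectors \<open>v\<^sub>m\<close> of \<open>\<real>\<^sup>n\<close> were orthonormal and \<open>\<sigma>\<^sub>n\<close>
  were equal to \<open>\<sigma> = sqrt (\<Sum>m. (lam m)\<^sup>2)\<close>, for then the \<open>\<langle>v\<^sub>m, Z\<rangle>\<close> would be independent standard
  normal variables. Both are true up to an error \<open>\<epsilon>\<close> of order \<open>1 / n powr \<alpha>\<close>: the inner products of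
  the \<open>v\<^sub>m\<close> are Riemann sums of the products \<open>e m * e l\<close>, whose integrals are those of an orthonormal
  system (\<open>holder_riemann_sum_error\<close>, \<open>sample_gram_near_identity\<close>), and \<open>\<sigma>\<^sub>n\<close> is a function of these
  inner products (\<open>sum_coef_squared_near\<close>).

  Gram-Schmidt turns the \<open>v\<^sub>m\<close> into orthonormal vectors \<open>u\<^sub>m\<close> at distance of order \<open>\<epsilon>\<close>
  (\<open>near_orthonormal_to_orthonormal\<close>). The variables \<open>W\<^sub>m = \<langle>u\<^sub>m, Z\<rangle>\<close> are independent standard normal,
  so \<open>\<Sum>m. (lam m / \<sigma>) * (W\<^sub>m\<^sup>2 - 1)\<close> has the limit law, and it lives on the same probability space as
  the form of order \<open>n\<close>. This pair is the coupling; the fourth moments of Gaussian variables bound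
  its cost by a multiple of \<open>\<epsilon>\<^sup>2\<close> (\<open>quadratic_form_L2_distance\<close>, \<open>W2_Q_n_Q_infinity_le\<close>).

  That the \<open>W\<^sub>m\<close> are independent standard normal variables is read off from their joint
  characteristic function: it factorises, which forces the joint law to be a product measure
  (\<open>joint_law_if_char_factorises\<close>). This is deduced from the one-dimensional uniqueness theorem of
  Levy by tilting the probability measure.
\<close>

section \<open>Joint laws with a factorising characteristic function\<close>

text \<open>
  The measure with density \<open>H / expectation H\<close> is a probability measure under which \<open>X\<close> has the
  characteristic function of \<open>\<nu>\<close>, hence the law \<open>\<nu>\<close> by Levy's uniqueness theorem. Tilting by a
  positive weight thus turns an identity between characteristic functions into one between
  probabilities, although the theorem only speaks of probability measures. The lower bound on \<open>H\<close>
  keeps the normalising constant away from \<open>0\<close>.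
\<close>

lemma (in prob_space) tilted_law:
  fixes X H :: "'a \<Rightarrow> real"
  assumes [measurable]: "X \<in> borel_measurable M" "H \<in> borel_measurable M"
    and H: "\<And>\<omega>. 1 \<le> H \<omega>" "\<And>\<omega>. H \<omega> \<le> B"
    and \<nu>: "real_distribution \<nu>"
    and char_eq: "\<And>t. (CLINT \<omega>|M. H \<omega> * iexp (t * X \<omega>)) = expectation H * char \<nu> t"
    and A[measurable]: "A \<in> sets borel"
  shows "expectation (\<lambda>\<omega>. H \<omega> * indicator A (X \<omega>)) = expectation H * measure \<nu> A"
proof -
  define p where "p = expectation H"
  have int_H: "integrable M H"
  proof (rule integrable_const_bound[where B=B])
    show "AE \<omega> in M. norm (H \<omega>) \<le> B"
    proof (rule AE_I2)
      show "norm (H \<omega>) \<le> B" for \<omega>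
        using H(1)[of \<omega>] H(2)[of \<omega>] by simp
    qed
  qed simp
  have "expectation (\<lambda>_. 1) \<le> p"
    unfolding p_def using int_H H(1) by (intro integral_mono) auto
  then have p: "1 \<le> p" by (simp add: prob_space)
  define D where "D = density M (\<lambda>\<omega>. ennreal (H \<omega> / p))"
  have H0: "0 \<le> H \<omega> / p" for \<omega> using H(1)[of \<omega>] p by simp
  have "emeasure D (space D) = (\<integral>\<^sup>+ \<omega>. ennreal (H \<omega> / p) \<partial>M)"
    unfolding D_def by (subst emeasure_density) (auto intro!: nn_integral_cong)
  also have "\<dots> = ennreal (expectation (\<lambda>\<omega>. H \<omega> / p))"
    using int_H H0 by (intro nn_integral_eq_integral) auto
  also have "\<dots> = 1" using p by (simp add: p_def)
  finally interpret D: prob_space D by (rule prob_spaceI)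
  have [measurable]: "X \<in> borel_measurable D" by (simp add: D_def)
  have "char (distr D borel X) t = char \<nu> t" for t
  proof -
    have "char (distr D borel X) t = (CLINT \<omega>|D. iexp (t * X \<omega>))"
      by (simp add: char_def integral_distr)
    also have "\<dots> = (CLINT \<omega>|M. (H \<omega> / p) *\<^sub>R iexp (t * X \<omega>))"
      unfolding D_def using H0 by (intro integral_density) auto
    also have "\<dots> = (CLINT \<omega>|M. (H \<omega> * iexp (t * X \<omega>)) / p)"
      by (intro Bochner_Integration.integral_cong) (auto simp: scaleR_conv_of_real)
    also have "\<dots> = char \<nu> t"
      using char_eq[of t] p by (simp add: p_def)
    finally show ?thesis .
  qed
  moreover have "real_distribution (distr D borel X)"
    by (intro real_distribution.intro D.prob_space_distr real_distribution_axioms.intro) auto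
  ultimately have law: "distr D borel X = \<nu>"
    using \<nu> by (intro Levy_uniqueness) auto
  have "measure \<nu> A = D.expectation (\<lambda>\<omega>. indicator A (X \<omega>))"
    by (subst law[symmetric], subst measure_distr) (auto simp: indicator_vimage[symmetric] comp_def intro!: arg_cong[where f="measure D"] simp flip: indicator_vimage)
  also have "\<dots> = expectation (\<lambda>\<omega>. (H \<omega> / p) *\<^sub>R indicator A (X \<omega>))"
    unfolding D_def using H0 by (intro integral_density) auto
  also have "\<dots> = expectation (\<lambda>\<omega>. H \<omega> * indicator A (X \<omega>)) / p"
    by simp
  finally show ?thesis using p by (simp add: p_def)
qed

lemma (in prob_space) integrable_iexp_real:
  assumes [measurable]: "X \<in> borel_measurable M"
  shows "integrable M (\<lambda>\<omega>. iexp (X \<omega>))"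
  by (intro integrable_iexp) auto

text \<open>
  The hypothesis lets \<open>iexp (t * X)\<close> be split off from the expectation of its product with any
  trigonometric polynomial in \<open>S\<close>. As \<open>iexp (S)\<close> is not a positive weight, it is first written
  through the weights \<open>2 + cos (S + \<theta>)\<close>, which take values in the interval from \<open>1\<close> to \<open>3\<close>: the
  choices \<open>\<theta> = 0\<close> and \<open>\<theta> = - pi / 2\<close> give its real and its imaginary part.
\<close>

lemma (in prob_space) expectation_indicator_mult_iexp:
  fixes X S :: "'a \<Rightarrow> real"
  assumes [measurable]: "X \<in> borel_measurable M" "S \<in> borel_measurable M"
    and \<nu>: "real_distribution \<nu>"
    and char_eq: "\<And>t c. (CLINT \<omega>|M. iexp (t * X \<omega> + c * S \<omega>)) = char \<nu> t * (CLINT \<omega>|M. iexp (c * S \<omega>))"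
    and A[measurable]: "A \<in> sets borel"
  shows "(CLINT \<omega>|M. indicator A (X \<omega>) * iexp (S \<omega>)) = measure \<nu> A * (CLINT \<omega>|M. iexp (S \<omega>))"
proof -
  have cos_iexp: "complex_of_real (cos x) = (iexp x + iexp (- x)) / 2" for x
    by (simp add: cos_of_real[symmetric] cos_exp_eq)
  have tilt: "expectation (\<lambda>\<omega>. (2 + cos (c * S \<omega> + \<theta>)) * indicator A (X \<omega>))
      = expectation (\<lambda>\<omega>. 2 + cos (c * S \<omega> + \<theta>)) * measure \<nu> A" for c \<theta>
  proof (rule tilted_law[where B=3])
    fix t
    have int: "integrable M (\<lambda>\<omega>. iexp (s * X \<omega> + c * S \<omega>))" for s c
      by (intro integrable_iexp_real) auto
    have expand: "complex_of_real (2 + cos (c * S \<omega> + \<theta>)) * iexp (s * X \<omega>)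
        = 2 * iexp (s * X \<omega> + 0 * S \<omega>) + iexp \<theta> / 2 * iexp (s * X \<omega> + c * S \<omega>)
          + iexp (- \<theta>) / 2 * iexp (s * X \<omega> + (- c) * S \<omega>)" for s \<omega>
      by (simp add: cos_iexp exp_add[symmetric] ring_distribs add_divide_distrib del: cos_of_real)
         (simp add: algebra_simps)
    have lin: "(CLINT \<omega>|M. a * f \<omega> + b * g \<omega> + d * h \<omega>)
        = a * integral\<^sup>L M f + b * integral\<^sup>L M g + d * integral\<^sup>L M h"
      if "integrable M f" "integrable M g" "integrable M h" for a b d :: complex and f g h
      using that by simp
    have total: "(CLINT \<omega>|M. complex_of_real (2 + cos (c * S \<omega> + \<theta>)) * iexp (s * X \<omega>))
        = 2 * (CLINT \<omega>|M. iexp (s * X \<omega> + 0 * S \<omega>)) + iexp \<theta> / 2 * (CLINT \<omega>|M. iexp (s * X \<omega> + c * S \<omega>))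
          + iexp (- \<theta>) / 2 * (CLINT \<omega>|M. iexp (s * X \<omega> + (- c) * S \<omega>))" for s
      unfolding expand by (rule lin[OF int int int])
    have "complex_of_real (expectation (\<lambda>\<omega>. 2 + cos (c * S \<omega> + \<theta>)))
       = (CLINT \<omega>|M. complex_of_real (2 + cos (c * S \<omega> + \<theta>)) * iexp (0 * X \<omega>))"
      by (subst integral_complex_of_real[symmetric]) (simp del: of_real_add)
    then show "(CLINT \<omega>|M. complex_of_real (2 + cos (c * S \<omega> + \<theta>)) * iexp (t * X \<omega>))
        = complex_of_real (expectation (\<lambda>\<omega>. 2 + cos (c * S \<omega> + \<theta>))) * char \<nu> t"
      unfolding total char_eq real_distribution.char_zero[OF \<nu>] by (simp only: ring_distribs mult_ac mult_1_left)
  next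
    show "1 \<le> 2 + cos (c * S \<omega> + \<theta>)" "2 + cos (c * S \<omega> + \<theta>) \<le> 3" for \<omega>
      using cos_ge_minus_one[of "c * S \<omega> + \<theta>"] cos_le_one[of "c * S \<omega> + \<theta>"] by linarith+
  qed (use \<nu> in auto)
  have int_cos: "integrable M (\<lambda>\<omega>. cos (c * S \<omega> + \<theta>))"
    and int_ind: "integrable M (\<lambda>\<omega>. indicator A (X \<omega>) :: real)"
    and int_cos_ind: "integrable M (\<lambda>\<omega>. cos (c * S \<omega> + \<theta>) * indicator A (X \<omega>))" for c \<theta>
    by (rule integrable_const_bound[where B=1]; auto simp: indicator_def)+
  have "expectation (\<lambda>\<omega>. indicator A (X \<omega>)) = measure \<nu> A"
    using tilt[of 0 0] by (simp add: prob_space)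
  then have cos_eq: "expectation (\<lambda>\<omega>. cos (1 * S \<omega> + \<theta>) * indicator A (X \<omega>))
      = expectation (\<lambda>\<omega>. cos (1 * S \<omega> + \<theta>)) * measure \<nu> A" for \<theta>
    using tilt[of 1 \<theta>] int_cos[of 1 \<theta>] int_ind int_cos_ind[of 1 \<theta>]
    by (simp add: ring_distribs prob_space)
  have decomp: "iexp x = of_real (cos (1 * x + 0)) + \<i> * of_real (cos (1 * x + (- pi / 2)))" for x
    by (simp add: cis_conv_exp[symmetric] complex_eq_iff cos_diff)
  have complex_split: "(CLINT \<omega>|M. complex_of_real (f \<omega>) + \<i> * complex_of_real (g \<omega>))
      = of_real (expectation f) + \<i> * of_real (expectation g)"
    if "integrable M f" "integrable M g" for f g
    using that by simp
  have "(CLINT \<omega>|M. indicator A (X \<omega>) * iexp (S \<omega>))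
     = (CLINT \<omega>|M. of_real (cos (1 * S \<omega> + 0) * indicator A (X \<omega>)) + \<i> * of_real (cos (1 * S \<omega> + (- pi / 2)) * indicator A (X \<omega>)))"
    by (intro Bochner_Integration.integral_cong refl) (subst decomp, simp add: indicator_def)
  also have "\<dots> = of_real (expectation (\<lambda>\<omega>. cos (1 * S \<omega> + 0) * indicator A (X \<omega>))) +
      \<i> * of_real (expectation (\<lambda>\<omega>. cos (1 * S \<omega> + (- pi / 2)) * indicator A (X \<omega>)))"
    by (rule complex_split) (rule int_cos_ind)+
  also have "\<dots> = measure \<nu> A * (of_real (expectation (\<lambda>\<omega>. cos (1 * S \<omega> + 0))) +
      \<i> * of_real (expectation (\<lambda>\<omega>. cos (1 * S \<omega> + (- pi / 2)))))"
    unfolding cos_eq by (simp add: algebra_simps)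
  also have "of_real (expectation (\<lambda>\<omega>. cos (1 * S \<omega> + 0))) +
      \<i> * of_real (expectation (\<lambda>\<omega>. cos (1 * S \<omega> + (- pi / 2)))) = (CLINT \<omega>|M. iexp (S \<omega>))"
    unfolding decomp[of "S _"] by (rule complex_split[symmetric]) (rule int_cos)+
  finally show ?thesis .
qed

text \<open>
  Induction on the number of coordinates, over all probability measures at once. Conditioning on
  the event that one coordinate lies in its set leaves the joint characteristic function of the
  other coordinates unchanged, by the previous lemma, so that the induction hypothesis applies to
  the conditioned measure.
\<close>

lemma prob_box_if_char_factorises:
  fixes X :: "'i \<Rightarrow> 'a \<Rightarrow> real"
  assumes "finite I" and "prob_space M"
    and "\<And>m. m \<in> I \<Longrightarrow> X m \<in> borel_measurable M"
    and "\<And>m. m \<in> I \<Longrightarrow> real_distribution (\<nu> m)"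
    and "\<And>t. (CLINT \<omega>|M. iexp (\<Sum>m\<in>I. t m * X m \<omega>)) = (\<Prod>m\<in>I. char (\<nu> m) (t m))"
    and "\<And>m. m \<in> I \<Longrightarrow> A m \<in> sets borel"
  shows "measure M {\<omega>\<in>space M. \<forall>m\<in>I. X m \<omega> \<in> A m} = (\<Prod>m\<in>I. measure (\<nu> m) (A m))"
  using assms
proof (induction I arbitrary: M rule: finite_induct)
  case empty
  then interpret prob_space M by simp
  show ?case by (simp add: prob_space)
next
  case (insert i I)
  interpret prob_space M by fact
  have X[measurable]: "\<And>m. m \<in> insert i I \<Longrightarrow> X m \<in> borel_measurable M"
    and \<nu>: "\<And>m. m \<in> insert i I \<Longrightarrow> real_distribution (\<nu> m)"
    and A[measurable]: "\<And>m. m \<in> insert i I \<Longrightarrow> A m \<in> sets borel"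
    using insert.prems by auto
  note [measurable] = X[OF insertI1] X[OF insertI2] A[OF insertI1] A[OF insertI2]
  note char_eq = insert.prems(4)
  have \<nu>0: "char (\<nu> m) 0 = 1" if "m \<in> insert i I" for m
    using real_distribution.char_zero[OF \<nu>[OF that]] .
  have char_I: "(CLINT \<omega>|M. iexp (\<Sum>m\<in>I. t m * X m \<omega>)) = (\<Prod>m\<in>I. char (\<nu> m) (t m))" for t
  proof -
    have "(\<Sum>m\<in>I. (t(i := 0)) m * X m \<omega>) = (\<Sum>m\<in>I. t m * X m \<omega>)" for \<omega>
      using insert.hyps by (intro sum.cong) auto
    moreover have "(\<Prod>m\<in>I. char (\<nu> m) ((t(i := 0)) m)) = (\<Prod>m\<in>I. char (\<nu> m) (t m))"
      using insert.hyps by (intro prod.cong) auto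
    ultimately show ?thesis
      using char_eq[of "t(i := 0)"] insert.hyps \<nu>0[of i] by simp
  qed
  define p where "p = measure (\<nu> i) (A i)"
  have split: "(CLINT \<omega>|M. indicator (A i) (X i \<omega>) * iexp (\<Sum>m\<in>I. t m * X m \<omega>))
      = p * (\<Prod>m\<in>I. char (\<nu> m) (t m))" for t
    unfolding p_def char_I[symmetric]
  proof (rule expectation_indicator_mult_iexp)
    fix s c :: real
    have 1: "(\<Sum>m\<in>insert i I. ((\<lambda>m. c * t m)(i := s)) m * X m \<omega>) = s * X i \<omega> + c * (\<Sum>m\<in>I. t m * X m \<omega>)" for \<omega>
    proof -
      have "(\<Sum>m\<in>I. ((\<lambda>m. c * t m)(i := s)) m * X m \<omega>) = (\<Sum>m\<in>I. c * (t m * X m \<omega>))"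
        using insert.hyps by (intro sum.cong) auto
      then show ?thesis using insert.hyps by (simp add: sum_distrib_left)
    qed
    have 2: "(\<Prod>m\<in>insert i I. char (\<nu> m) (((\<lambda>m. c * t m)(i := s)) m)) = char (\<nu> i) s * (\<Prod>m\<in>I. char (\<nu> m) (c * t m))"
    proof -
      have "(\<Prod>m\<in>I. char (\<nu> m) (((\<lambda>m. c * t m)(i := s)) m)) = (\<Prod>m\<in>I. char (\<nu> m) (c * t m))"
        using insert.hyps by (intro prod.cong) auto
      then show ?thesis using insert.hyps by simp
    qed
    show "(CLINT \<omega>|M. iexp (s * X i \<omega> + c * (\<Sum>m\<in>I. t m * X m \<omega>)))
      = char (\<nu> i) s * (CLINT \<omega>|M. iexp (c * (\<Sum>m\<in>I. t m * X m \<omega>)))"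
      using char_eq[of "(\<lambda>m. c * t m)(i := s)"] char_I[of "\<lambda>m. c * t m"]
      unfolding 1 2 by (simp add: sum_distrib_left mult.assoc)
  qed (use \<nu> in auto)
  define E where "E = {\<omega>\<in>space M. X i \<omega> \<in> A i}"
  have E[measurable]: "E \<in> sets M" unfolding E_def by measurable
  have prob_E: "prob E = p"
  proof -
    have "complex_of_real (prob E) = complex_of_real (expectation (indicator E))"
      by simp
    also have "\<dots> = (CLINT \<omega>|M. complex_of_real (indicator E \<omega>))"
      by (rule integral_complex_of_real[symmetric])
    also have "\<dots> = (CLINT \<omega>|M. indicator (A i) (X i \<omega>) * iexp (\<Sum>m\<in>I. (\<lambda>_. 0) m * X m \<omega>))"
      by (intro Bochner_Integration.integral_cong) (auto simp: E_def indicator_def)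
    also have "\<dots> = p"
      unfolding split using \<nu>0 by (subst prod.neutral) auto
    finally show ?thesis by simp
  qed
  have sub: "{\<omega>\<in>space M. \<forall>m\<in>insert i I. X m \<omega> \<in> A m} = E \<inter> {\<omega>\<in>space M. \<forall>m\<in>I. X m \<omega> \<in> A m}"
    by (auto simp: E_def)
  have box[measurable]: "{\<omega>\<in>space M. \<forall>m\<in>I. X m \<omega> \<in> A m} \<in> sets M"
    using insert.hyps by measurable
  show ?case
  (* if the event E is null, there is nothing to condition on and both sides vanish *)
  proof (cases "p = 0")
    case True
    have "prob {\<omega>\<in>space M. \<forall>m\<in>insert i I. X m \<omega> \<in> A m} \<le> prob E"
      unfolding sub by (intro finite_measure_mono) auto
    with True prob_E insert.hyps show ?thesis
      by (simp add: p_def measure_le_0_iff)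
  next
    case False
    then have p: "0 < p" by (simp add: p_def less_le)
    define D where "D = uniform_measure M E"
    have E0: "emeasure M E \<noteq> 0" "emeasure M E \<noteq> \<infinity>"
      using p prob_E by (auto simp: emeasure_eq_measure)
    interpret D: prob_space D unfolding D_def by (rule prob_space_uniform_measure) fact+
    have space_D: "space D = space M" by (simp add: D_def)
    have D_density: "D = density M (\<lambda>\<omega>. ennreal (indicator E \<omega> / p))"
      unfolding D_def uniform_measure_def using p prob_E
      by (intro density_cong) (auto simp: emeasure_eq_measure divide_ennreal indicator_def ennreal_1[symmetric] simp del: ennreal_1)
    have "D.prob {\<omega>\<in>space D. \<forall>m\<in>I. X m \<omega> \<in> A m} = (\<Prod>m\<in>I. measure (\<nu> m) (A m))"
    proof (rule insert.IH)
      show "X m \<in> borel_measurable D" if "m \<in> I" for m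
        using X that by (simp add: D_def)
      show "D.expectation (\<lambda>\<omega>. iexp (\<Sum>m\<in>I. t m * X m \<omega>)) = (\<Prod>m\<in>I. char (\<nu> m) (t m))" for t
      proof -
        have "D.expectation (\<lambda>\<omega>. iexp (\<Sum>m\<in>I. t m * X m \<omega>))
          = (CLINT \<omega>|M. (indicator E \<omega> / p) *\<^sub>R iexp (\<Sum>m\<in>I. t m * X m \<omega>))"
          unfolding D_density using p by (intro integral_density) auto
        also have "\<dots> = (CLINT \<omega>|M. indicator (A i) (X i \<omega>) * iexp (\<Sum>m\<in>I. t m * X m \<omega>) / p)"
          by (intro Bochner_Integration.integral_cong) (auto simp: E_def indicator_def scaleR_conv_of_real)
        also have "\<dots> = (CLINT \<omega>|M. indicator (A i) (X i \<omega>) * iexp (\<Sum>m\<in>I. t m * X m \<omega>)) / p"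
          by (rule integral_divide_zero)
        also have "\<dots> = (\<Prod>m\<in>I. char (\<nu> m) (t m))"
          unfolding split using p by simp
        finally show ?thesis .
      qed
    qed (use \<nu> A D.prob_space_axioms in auto)
    moreover have "D.prob {\<omega>\<in>space M. \<forall>m\<in>I. X m \<omega> \<in> A m} = prob {\<omega>\<in>space M. \<forall>m\<in>insert i I. X m \<omega> \<in> A m} / p"
      unfolding sub D_def using E0 prob_E by (subst measure_uniform_measure) auto
    ultimately show ?thesis
      using p insert.hyps by (simp add: space_D p_def field_simps)
  qed
qed

text \<open>
  This is Kac's theorem: a joint characteristic function that is a product of characteristic
  functions belongs to a product measure, for product measures are determined by their values on
  boxes.
\<close>

lemma (in prob_space) joint_law_if_char_factorises:
  fixes X :: "'i \<Rightarrow> 'a \<Rightarrow> real"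
  assumes "finite I"
    and X: "\<And>m. m \<in> I \<Longrightarrow> X m \<in> borel_measurable M"
    and \<nu>: "\<And>m. real_distribution (\<nu> m)"
    and char_eq: "\<And>t. (CLINT \<omega>|M. iexp (\<Sum>m\<in>I. t m * X m \<omega>)) = (\<Prod>m\<in>I. char (\<nu> m) (t m))"
  shows "distr M (\<Pi>\<^sub>M m\<in>I. borel) (\<lambda>\<omega>. \<lambda>m\<in>I. X m \<omega>) = (\<Pi>\<^sub>M m\<in>I. \<nu> m)"
proof -
  have prob_\<nu>: "prob_space (\<nu> m)" and sets_\<nu>: "sets (\<nu> m) = sets borel" for m
    using \<nu>[of m] by (auto simp: real_distribution_def real_distribution.events_eq_borel)
  interpret \<nu>: product_prob_space \<nu> I
    using prob_\<nu> by (intro product_prob_spaceI)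
  have vec: "(\<lambda>\<omega>. \<lambda>m\<in>I. X m \<omega>) \<in> measurable M (\<Pi>\<^sub>M m\<in>I. borel)"
    by (rule measurable_restrict) (rule X)
  show ?thesis
  proof (rule \<nu>.PiM_eqI)
    show "finite I" by fact
    show "sets (distr M (\<Pi>\<^sub>M m\<in>I. borel) (\<lambda>\<omega>. \<lambda>m\<in>I. X m \<omega>)) = sets (Pi\<^sub>M I \<nu>)"
      using sets_\<nu> by (auto intro!: sets_PiM_cong)
    fix A assume "\<And>m. m \<in> I \<Longrightarrow> A m \<in> sets (\<nu> m)"
    then have A: "m \<in> I \<Longrightarrow> A m \<in> sets borel" for m using sets_\<nu> by auto
    have box: "Pi\<^sub>E I A \<in> sets (\<Pi>\<^sub>M m\<in>I. borel)"
      using \<open>finite I\<close> A by (intro sets_PiM_I_finite) auto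
    have "emeasure (distr M (\<Pi>\<^sub>M m\<in>I. borel) (\<lambda>\<omega>. \<lambda>m\<in>I. X m \<omega>)) (Pi\<^sub>E I A)
      = emeasure M {\<omega>\<in>space M. \<forall>m\<in>I. X m \<omega> \<in> A m}"
      by (subst emeasure_distr[OF vec box]) (auto intro!: arg_cong[where f="emeasure M"])
    also have "\<dots> = ennreal (\<Prod>m\<in>I. measure (\<nu> m) (A m))"
      using prob_box_if_char_factorises[OF \<open>finite I\<close> prob_space_axioms X \<nu> char_eq A]
      by (simp add: emeasure_eq_measure)
    also have "\<dots> = (\<Prod>m\<in>I. emeasure (\<nu> m) (A m))"
      using prob_\<nu> by (subst prod_ennreal[symmetric])
        (auto intro!: prod.cong simp: finite_measure.emeasure_eq_measure prob_space_def)
    finally show "emeasure (distr M (\<Pi>\<^sub>M m\<in>I. borel) (\<lambda>\<omega>. \<lambda>m\<in>I. X m \<omega>)) (Pi\<^sub>E I A)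
      = (\<Prod>m\<in>I. emeasure (\<nu> m) (A m))" .
  qed
qed

section \<open>Orthonormalising almost orthonormal vectors\<close>

lemma L2_set_diff_triangle: "L2_set (\<lambda>i. f i - h i) J \<le> L2_set (\<lambda>i. f i - g i) J + L2_set (\<lambda>i. g i - h i) J"
  using L2_set_triangle_ineq[of "\<lambda>i. f i - g i" "\<lambda>i. g i - h i" J] by simp

lemma L2_set_diff_commute: "L2_set (\<lambda>i. f i - g i) J = L2_set (\<lambda>i. g i - f i) J"
  by (simp add: L2_set_def power2_commute)

lemma L2_set_scale: "L2_set (\<lambda>i. c * f i) J = \<bar>c\<bar> * L2_set f J"
  by (simp add: L2_set_def power_mult_distrib sum_distrib_left[symmetric] real_sqrt_mult)

lemma L2_set_power2: "(L2_set f J)\<^sup>2 = (\<Sum>i\<in>J. f i * f i)"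
  by (simp add: L2_set_def sum_nonneg power2_eq_square[symmetric])

lemma abs_sum_mult_le_L2_set: "\<bar>\<Sum>i\<in>J. f i * g i\<bar> \<le> L2_set f J * L2_set g J"
  using sum_abs[of "\<lambda>i. f i * g i" J] L2_set_mult_ineq[of f g J] by (simp add: abs_mult)

text \<open>
  Gram-Schmidt orthonormalisation is Lipschitz near an orthonormal family. The statement is
  quantitative because \<open>K\<close> and \<open>\<delta>\<close> have to be independent of \<open>J\<close>: the vectors to which it is
  applied live in \<open>\<real>\<^sup>n\<close> with \<open>n\<close> tending to infinity, while their number stays fixed.
  In the induction step the new vector \<open>v i\<close> has components of size at most \<open>(1 + 2 * K) * \<epsilon>\<close>
  along the vectors \<open>u m\<close> already constructed and length within \<open>\<epsilon>\<close> of \<open>1\<close>; subtracting these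
  components and normalising therefore moves it by a multiple of \<open>\<epsilon>\<close> only.
\<close>

lemma near_orthonormal_to_orthonormal:
  assumes "finite I"
  shows "\<exists>K>0. \<exists>\<delta>>0. \<forall>\<epsilon> (J::'j set) v. 0 \<le> \<epsilon> \<longrightarrow> \<epsilon> \<le> \<delta> \<longrightarrow>
    (\<forall>m\<in>I. \<forall>l\<in>I. \<bar>(\<Sum>j\<in>J. v m j * v l j) - (if m = l then 1 else 0)\<bar> \<le> \<epsilon>) \<longrightarrow>
    (\<exists>u. (\<forall>m\<in>I. \<forall>l\<in>I. (\<Sum>j\<in>J. u m j * u l j) = (if m = l then 1 else 0 :: real)) \<and>
      (\<forall>m\<in>I. L2_set (\<lambda>j. v m j - u m j) J \<le> K * \<epsilon>))"
  using assms
proof (induction I rule: finite_induct)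
  case empty
  show ?case
  proof (intro exI conjI allI impI)
    show "(0::real) < 1" "(0::real) < 1" by simp_all
  qed simp_all
next
  case (insert i I)
  obtain K \<delta> where K: "0 < K" and \<delta>: "0 < \<delta>" and IH:
    "\<forall>\<epsilon> (J::'j set) v. 0 \<le> \<epsilon> \<longrightarrow> \<epsilon> \<le> \<delta> \<longrightarrow>
      (\<forall>m\<in>I. \<forall>l\<in>I. \<bar>(\<Sum>j\<in>J. v m j * v l j) - (if m = l then 1 else 0)\<bar> \<le> \<epsilon>) \<longrightarrow>
      (\<exists>u. (\<forall>m\<in>I. \<forall>l\<in>I. (\<Sum>j\<in>J. u m j * u l j) = (if m = l then 1 else 0 :: real)) \<and>
        (\<forall>m\<in>I. L2_set (\<lambda>j. v m j - u m j) J \<le> K * \<epsilon>))"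
    using insert.IH by (elim exE conjE) (rule that)
  (* A * \<epsilon> bounds the projection of the new vector onto the old ones; \<delta>' is so small that the
     remainder keeps at least length 1 / 2 and can be normalised *)
  define A where "A = card I * (1 + 2 * K)"
  have A: "0 \<le> A" using K by (simp add: A_def)
  define K' where "K' = K + 2 * A + 1"
  define \<delta>' where "\<delta>' = min \<delta> (1 / (2 * (A + 1)))"
  have K': "0 < K'" "K \<le> K'" "2 * A + 1 \<le> K'" using K A by (auto simp: K'_def)
  have \<delta>': "0 < \<delta>'" using \<delta> A by (simp add: \<delta>'_def)
  show ?case
  proof (rule exI[of _ K'], rule conjI, rule K'(1), rule exI[of _ \<delta>'], rule conjI, rule \<delta>',
      intro allI impI)
    fix \<epsilon> and J :: "'j set" and v
    assume \<epsilon>: "0 \<le> \<epsilon>" "\<epsilon> \<le> \<delta>'" and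
      near: "\<forall>m\<in>insert i I. \<forall>l\<in>insert i I. \<bar>(\<Sum>j\<in>J. v m j * v l j) - (if m = l then 1 else 0)\<bar> \<le> \<epsilon>"
    have A\<epsilon>: "(A + 1) * \<epsilon> \<le> 1 / 2"
    proof -
      have "(A + 1) * \<epsilon> \<le> (A + 1) * (1 / (2 * (A + 1)))"
        using \<epsilon> A by (intro mult_left_mono) (auto simp: \<delta>'_def)
      also have "\<dots> = 1 / 2" using A by simp
      finally show ?thesis .
    qed
    then have \<epsilon>1: "\<epsilon> \<le> 1 / 2"
      using mult_nonneg_nonneg[OF A \<epsilon>(1)] unfolding ring_distribs by linarith
    obtain u where orth: "\<And>m l. m \<in> I \<Longrightarrow> l \<in> I \<Longrightarrow> (\<Sum>j\<in>J. u m j * u l j) = (if m = l then 1 else 0 :: real)"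
      and close: "\<And>m. m \<in> I \<Longrightarrow> L2_set (\<lambda>j. v m j - u m j) J \<le> K * \<epsilon>"
    proof -
      have "\<epsilon> \<le> \<delta>" using \<epsilon> by (simp add: \<delta>'_def)
      moreover have "\<forall>m\<in>I. \<forall>l\<in>I. \<bar>(\<Sum>j\<in>J. v m j * v l j) - (if m = l then 1 else 0)\<bar> \<le> \<epsilon>"
        using near by blast
      ultimately show thesis
        using IH[THEN spec, of \<epsilon>, THEN spec, of J, THEN spec, of v] \<epsilon>(1) that by blast
    qed
    define c where "c m = (\<Sum>j\<in>J. v i j * u m j)" for m
    define w where "w j = v i j - (\<Sum>m\<in>I. c m * u m j)" for j
    define r where "r = L2_set w J"
    have v_sq: "\<bar>(L2_set (v i) J)\<^sup>2 - 1\<bar> \<le> \<epsilon>"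
      using near[rule_format, of i i] by (simp add: L2_set_power2)
    have v_norm: "\<bar>L2_set (v i) J - 1\<bar> \<le> \<epsilon>"
    proof -
      have "\<bar>L2_set (v i) J - 1\<bar> * 1 \<le> \<bar>L2_set (v i) J - 1\<bar> * (L2_set (v i) J + 1)"
        by (intro mult_left_mono) auto
      also have "\<dots> = \<bar>(L2_set (v i) J)\<^sup>2 - 1\<bar>"
      proof -
        have "(L2_set (v i) J)\<^sup>2 - 1 = (L2_set (v i) J - 1) * (L2_set (v i) J + 1)"
          by (simp add: power2_eq_square algebra_simps)
        then show ?thesis by (simp add: abs_mult)
      qed
      finally show ?thesis using v_sq by simp
    qed
    have c_bound: "\<bar>c m\<bar> \<le> (1 + 2 * K) * \<epsilon>" if m: "m \<in> I" for m
    proof -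
      have im: "i \<noteq> m" using insert.hyps m by auto
      have "c m = (\<Sum>j\<in>J. v i j * v m j) + (\<Sum>j\<in>J. v i j * (u m j - v m j))"
        unfolding c_def sum.distrib[symmetric] by (intro sum.cong) (auto simp: algebra_simps)
      then have "\<bar>c m\<bar> \<le> \<bar>\<Sum>j\<in>J. v i j * v m j\<bar> + \<bar>\<Sum>j\<in>J. v i j * (u m j - v m j)\<bar>"
        by simp
      also have "\<dots> \<le> \<epsilon> + 2 * (K * \<epsilon>)"
      proof (rule add_mono)
        show "\<bar>\<Sum>j\<in>J. v i j * v m j\<bar> \<le> \<epsilon>" using near[rule_format, of i m] m im by simp
        have "\<bar>\<Sum>j\<in>J. v i j * (u m j - v m j)\<bar> \<le> L2_set (v i) J * L2_set (\<lambda>j. u m j - v m j) J"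
          by (rule abs_sum_mult_le_L2_set)
        also have "\<dots> \<le> 2 * (K * \<epsilon>)"
          using v_norm \<epsilon>1 close[OF m] K \<epsilon> by (intro mult_mono) (auto simp: L2_set_diff_commute[of "u m"])
        finally show "\<bar>\<Sum>j\<in>J. v i j * (u m j - v m j)\<bar> \<le> 2 * (K * \<epsilon>)" .
      qed
      finally show ?thesis by (simp add: algebra_simps)
    qed
    have w_close: "L2_set (\<lambda>j. v i j - w j) J \<le> A * \<epsilon>"
    proof -
      have L2_sum: "L2_set (\<lambda>j. \<Sum>m\<in>F. f m j) J \<le> (\<Sum>m\<in>F. L2_set (f m) J)" if "finite F" for F and f :: "_ \<Rightarrow> 'j \<Rightarrow> real"
        using that by (induction F rule: finite_induct)
          (auto simp: L2_set_0' intro: order_trans[OF L2_set_triangle_ineq])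
      have "L2_set (\<lambda>j. v i j - w j) J = L2_set (\<lambda>j. \<Sum>m\<in>I. c m * u m j) J"
        by (simp add: w_def)
      also have "\<dots> \<le> (\<Sum>m\<in>I. L2_set (\<lambda>j. c m * u m j) J)"
        by (rule L2_sum) fact
      also have "\<dots> = (\<Sum>m\<in>I. \<bar>c m\<bar>)"
      proof (rule sum.cong)
        fix m assume m: "m \<in> I"
        have "L2_set (u m) J = 1" using orth[OF m m] by (simp add: L2_set_def power2_eq_square)
        then show "L2_set (\<lambda>j. c m * u m j) J = \<bar>c m\<bar>" by (simp add: L2_set_scale)
      qed simp
      also have "\<dots> \<le> (\<Sum>m\<in>I. (1 + 2 * K) * \<epsilon>)"
        by (intro sum_mono c_bound)
      finally show ?thesis by (simp add: A_def mult.assoc)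
    qed
    have r_near: "\<bar>r - 1\<bar> \<le> (A + 1) * \<epsilon>"
    proof -
      have "r \<le> L2_set (v i) J + A * \<epsilon>" "L2_set (v i) J \<le> r + A * \<epsilon>"
        using L2_set_diff_triangle[of w "\<lambda>_. 0" J "v i"] L2_set_diff_triangle[of "v i" "\<lambda>_. 0" J w] w_close
        by (auto simp: r_def L2_set_diff_commute[of w])
      then show ?thesis using v_norm by (simp add: ring_distribs abs_le_iff)
    qed
    then have r: "1 / 2 \<le> r" using A\<epsilon> by simp
    have w_orth: "(\<Sum>j\<in>J. w j * u m j) = 0" if m: "m \<in> I" for m
    proof -
      have "(\<Sum>j\<in>J. w j * u m j) = c m - (\<Sum>j\<in>J. \<Sum>l\<in>I. c l * (u l j * u m j))"
        by (simp add: w_def c_def left_diff_distrib sum_subtractf sum_distrib_right mult.assoc)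
      also have "(\<Sum>j\<in>J. \<Sum>l\<in>I. c l * (u l j * u m j)) = (\<Sum>l\<in>I. c l * (\<Sum>j\<in>J. u l j * u m j))"
        by (subst sum.swap) (simp add: sum_distrib_left)
      also have "\<dots> = (\<Sum>l\<in>I. if l = m then c l else 0)"
        using orth m by (intro sum.cong) auto
      also have "\<dots> = c m" using m \<open>finite I\<close> by simp
      finally show ?thesis by simp
    qed
    define u' where "u' = u(i := (\<lambda>j. w j / r))"
    have u'_i: "u' i j = w j / r" and u'_I: "m \<in> I \<Longrightarrow> u' m = u m" for m j
      using insert.hyps by (auto simp: u'_def)
    show "\<exists>u. (\<forall>m\<in>insert i I. \<forall>l\<in>insert i I. (\<Sum>j\<in>J. u m j * u l j) = (if m = l then 1 else 0 :: real)) \<and>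
      (\<forall>m\<in>insert i I. L2_set (\<lambda>j. v m j - u m j) J \<le> K' * \<epsilon>)"
    proof (intro exI[of _ u'] conjI ballI)
      fix m l assume ml: "m \<in> insert i I" "l \<in> insert i I"
      have ii: "(\<Sum>j\<in>J. u' i j * u' i j) = 1"
      proof -
        have "(\<Sum>j\<in>J. u' i j * u' i j) = (\<Sum>j\<in>J. w j * w j) / r\<^sup>2"
          by (simp add: u'_i sum_divide_distrib power2_eq_square)
        then show ?thesis using r by (simp add: r_def L2_set_power2[symmetric])
      qed
      have iI: "(\<Sum>j\<in>J. u' i j * u' l j) = 0" "(\<Sum>j\<in>J. u' l j * u' i j) = 0" if "l \<in> I" for l
        using w_orth[OF that] that
        by (simp_all add: u'_i u'_I sum_divide_distrib[symmetric] mult.commute[of "u l _"])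
      show "(\<Sum>j\<in>J. u' m j * u' l j) = (if m = l then 1 else 0)"
        using ml ii iI orth insert.hyps by (auto simp: u'_I)
    next
      fix m assume m: "m \<in> insert i I"
      show "L2_set (\<lambda>j. v m j - u' m j) J \<le> K' * \<epsilon>"
      proof (cases "m = i")
        case False
        then have "L2_set (\<lambda>j. v m j - u' m j) J \<le> K * \<epsilon>" using m close by (auto simp: u'_I)
        also have "\<dots> \<le> K' * \<epsilon>" using K' \<epsilon> by (intro mult_right_mono) auto
        finally show ?thesis .
      next
        case True
        have "L2_set (\<lambda>j. w j - u' i j) J = L2_set (\<lambda>j. (1 - 1 / r) * w j) J"
          by (simp add: u'_i algebra_simps)
        also have "\<dots> = \<bar>(1 - 1 / r) * r\<bar>"
          by (simp add: L2_set_scale abs_mult r_def)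
        also have "\<dots> = \<bar>r - 1\<bar>" using r by (simp add: left_diff_distrib)
        finally have "L2_set (\<lambda>j. v i j - u' i j) J \<le> A * \<epsilon> + (A + 1) * \<epsilon>"
          using L2_set_diff_triangle[of "v i" "u' i" J w] w_close r_near by simp
        also have "\<dots> = (2 * A + 1) * \<epsilon>" by (simp add: algebra_simps)
        also have "\<dots> \<le> K' * \<epsilon>" using K' \<epsilon> by (intro mult_right_mono) auto
        finally show ?thesis using True by simp
      qed
    qed
  qed
qed

section \<open>Riemann sums of Hoelder functions\<close>

lemma holder_on_continuous_on:
  assumes "holder_on \<alpha> S f" "0 < \<alpha>"
  shows "continuous_on S f"
  unfolding continuous_on_def
proof
  fix x assume x: "x \<in> S"
  obtain C where C: "\<And>x y. x \<in> S \<Longrightarrow> y \<in> S \<Longrightarrow> \<bar>f x - f y\<bar> \<le> C * \<bar>x - y\<bar> powr \<alpha>"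
    using assms(1) by (auto simp: holder_on_def)
  have "((\<lambda>y. C * \<bar>y - x\<bar> powr \<alpha>) \<longlongrightarrow> 0) (at x within S)"
  proof -
    have "((\<lambda>y. \<bar>y - x\<bar>) \<longlongrightarrow> 0) (at x within S)"
      by (auto intro!: tendsto_eq_intros)
    then have "((\<lambda>y. \<bar>y - x\<bar> powr \<alpha>) \<longlongrightarrow> 0 powr \<alpha>) (at x within S)"
      using \<open>0 < \<alpha>\<close> by (intro tendsto_powr') auto
    then show ?thesis by (auto intro: tendsto_mult_right_zero)
  qed
  then have "((\<lambda>y. f y - f x) \<longlongrightarrow> 0) (at x within S)"
    by (rule Lim_null_comparison[rotated]) (auto simp: eventually_at_filter intro!: always_eventually C x)
  then show "(f \<longlongrightarrow> f x) (at x within S)"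
    by (simp add: LIM_zero_iff)
qed

lemma holder_on_mult:
  assumes f: "holder_on \<alpha> S f" and g: "holder_on \<alpha> S g" and "0 < \<alpha>" and "compact S"
  shows "holder_on \<alpha> S (\<lambda>x. f x * g x)"
proof -
  have bounded: "\<exists>B\<ge>0. \<forall>x\<in>S. \<bar>h x\<bar> \<le> B" if "holder_on \<alpha> S h" for h
  proof -
    have "bounded (h ` S)"
      using that assms by (intro compact_imp_bounded compact_continuous_image holder_on_continuous_on)
    then obtain B where "0 < B" "\<forall>x\<in>S. \<bar>h x\<bar> \<le> B" by (auto simp: bounded_pos)
    then show ?thesis by (intro exI[of _ B]) auto
  qed
  obtain A B where A: "0 \<le> A" "\<And>x. x \<in> S \<Longrightarrow> \<bar>f x\<bar> \<le> A" and B: "0 \<le> B" "\<And>x. x \<in> S \<Longrightarrow> \<bar>g x\<bar> \<le> B"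
    using bounded[OF f] bounded[OF g] by metis
  obtain C D where C: "\<And>x y. x \<in> S \<Longrightarrow> y \<in> S \<Longrightarrow> \<bar>f x - f y\<bar> \<le> C * \<bar>x - y\<bar> powr \<alpha>"
    and D: "\<And>x y. x \<in> S \<Longrightarrow> y \<in> S \<Longrightarrow> \<bar>g x - g y\<bar> \<le> D * \<bar>x - y\<bar> powr \<alpha>"
    using f g unfolding holder_on_def by metis
  show ?thesis
    unfolding holder_on_def
  proof (intro exI[of _ "A * D + C * B"] ballI)
    fix x y assume xy: "x \<in> S" "y \<in> S"
    have "\<bar>f x * g x - f y * g y\<bar> = \<bar>f x * (g x - g y) + (f x - f y) * g y\<bar>"
      by (simp add: algebra_simps)
    also have "\<dots> \<le> \<bar>f x\<bar> * \<bar>g x - g y\<bar> + \<bar>f x - f y\<bar> * \<bar>g y\<bar>"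
      by (simp add: abs_triangle_ineq flip: abs_mult)
    also have "\<dots> \<le> A * (D * \<bar>x - y\<bar> powr \<alpha>) + (C * \<bar>x - y\<bar> powr \<alpha>) * B"
      using A B C D xy order_trans[OF abs_ge_zero C[OF xy]] by (intro add_mono mult_mono) auto
    finally show "\<bar>f x * g x - f y * g y\<bar> \<le> (A * D + C * B) * \<bar>x - y\<bar> powr \<alpha>"
      by (simp add: algebra_simps)
  qed
qed

text \<open>
  On each of the \<open>n\<close> intervals of length \<open>1 / n\<close> the function differs from its value at the right
  end point by at most \<open>C / n powr \<alpha>\<close>.
\<close>

lemma holder_riemann_sum_error:
  assumes "holder_on \<alpha> {0..1} f" "0 < \<alpha>"
  shows "\<exists>C\<ge>0. \<forall>n\<ge>1. \<bar>1 / real n * (\<Sum>i=1..n. f (real i / real n)) - (LINT x:{0<..<1}|lborel. f x)\<bar>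
    \<le> C * real n powr - \<alpha>"
proof -
  obtain C where C: "\<And>x y. x \<in> {0..1} \<Longrightarrow> y \<in> {0..1} \<Longrightarrow> \<bar>f x - f y\<bar> \<le> C * \<bar>x - y\<bar> powr \<alpha>"
    using assms(1) unfolding holder_on_def by metis
  have C0: "0 \<le> C" using C[of 0 1] by simp
  have cont: "continuous_on {0..1} f"
    using assms by (rule holder_on_continuous_on)
  have "set_integrable lborel {0..1} f"
    unfolding set_integrable_def using cont by (intro borel_integrable_compact) auto
  then have "set_integrable lborel {0<..<1} f"
    by (rule set_integrable_subset) auto
  then have int_eq: "(LINT x:{0<..<1}|lborel. f x) = integral {0..1} f"
    by (simp add: set_borel_integral_eq_integral integral_open_interval_real)
  show ?thesis
  proof (intro exI[of _ C] conjI C0 allI impI)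
    fix n :: nat assume n: "1 \<le> n"
    define h where "h = 1 / real n"
    have partial: "\<bar>h * (\<Sum>i=1..k. f (real i * h)) - integral {0..real k * h} f\<bar> \<le> k * (C * h powr \<alpha> * h)" if "k \<le> n" for k
      using that
    proof (induction k)
      case 0
      show ?case by simp
    next
      case (Suc k)
      have kh: "0 \<le> k * h" "k * h \<le> Suc k * h" "Suc k * h \<le> 1"
        using Suc.prems n by (auto simp: h_def field_simps)
      have h: "Suc k * h - k * h = h" "0 \<le> h" by (simp_all add: h_def add_divide_distrib)
      have cont': "continuous_on {k * h..Suc k * h} f"
        using kh by (intro continuous_on_subset[OF cont]) auto
      have "f integrable_on {0..Suc k * h}"
        using kh by (intro integrable_continuous_real continuous_on_subset[OF cont]) auto
      then have "integral {0..Suc k * h} f = integral {0..real k * h} f + integral {k * h..Suc k * h} f"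
        using kh by (intro Henstock_Kurzweil_Integration.integral_combine[symmetric]) auto
      moreover have "\<bar>h * f (Suc k * h) - integral {k * h..Suc k * h} f\<bar> \<le> C * h powr \<alpha> * h"
      proof -
        have "norm (integral {k * h..Suc k * h} (\<lambda>x. f (Suc k * h) - f x)) \<le> C * h powr \<alpha> * (Suc k * h - k * h)"
        proof (rule integral_bound)
          fix x assume x: "x \<in> {k * h..Suc k * h}"
          have "\<bar>f (Suc k * h) - f x\<bar> \<le> C * \<bar>Suc k * h - x\<bar> powr \<alpha>"
            using x kh by (intro C) auto
          also have "\<dots> \<le> C * h powr \<alpha>"
            using x h C0 \<open>0 < \<alpha>\<close> by (intro mult_left_mono powr_mono2) auto
          finally show "norm (f (Suc k * h) - f x) \<le> C * h powr \<alpha>" by simp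
        qed (use kh cont' in \<open>auto intro!: continuous_intros\<close>)
        moreover have "integral {k * h..Suc k * h} (\<lambda>x. f (Suc k * h) - f x)
          = h * f (Suc k * h) - integral {k * h..Suc k * h} f"
          using cont' kh(2) h(1) by (subst Henstock_Kurzweil_Integration.integral_diff)
            (auto intro!: integrable_continuous_real simp del: of_nat_Suc)
        ultimately show ?thesis using h by simp
      qed
      moreover have "h * (\<Sum>i=1..Suc k. f (real i * h)) = h * (\<Sum>i=1..k. f (real i * h)) + h * f (Suc k * h)"
        by (simp add: ring_distribs)
      moreover have "Suc k * (C * h powr \<alpha> * h) = k * (C * h powr \<alpha> * h) + C * h powr \<alpha> * h"
        by (simp add: ring_distribs)
      moreover have "\<bar>h * (\<Sum>i=1..k. f (real i * h)) - integral {0..real k * h} f\<bar> \<le> k * (C * h powr \<alpha> * h)"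
        using Suc by simp
      ultimately show ?case by linarith
    qed
    have "n * (C * h powr \<alpha> * h) = C * h powr \<alpha>"
      using n by (simp add: h_def)
    moreover have "h powr \<alpha> = real n powr - \<alpha>"
      using n by (simp add: h_def powr_divide powr_minus_divide)
    ultimately have "n * (C * h powr \<alpha> * h) = C * real n powr - \<alpha>"
      by (simp only:)
    moreover have "\<bar>h * (\<Sum>i=1..n. f (real i * h)) - integral {0..1} f\<bar> \<le> n * (C * h powr \<alpha> * h)"
      using partial[of n] n by (simp add: h_def)
    ultimately show "\<bar>1 / real n * (\<Sum>i=1..n. f (real i / real n)) - (LINT x:{0<..<1}|lborel. f x)\<bar>
      \<le> C * real n powr - \<alpha>"
      unfolding int_eq by (simp add: h_def)
  qed
qed

section \<open>Quadratic forms in independent normal variables\<close>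

lemma (in prob_space) char_gaussian_lincomb:
  assumes "indep_vars (\<lambda>_. borel) Z J"
    and Z: "\<And>j. j \<in> J \<Longrightarrow> distr M borel (Z j) = std_normal_distribution"
  shows "(CLINT \<omega>|M. iexp (\<Sum>j\<in>J. c j * Z j \<omega>)) = of_real (exp (- (\<Sum>j\<in>J. (c j)\<^sup>2) / 2))"
proof (cases "finite J")
  case False
  then show ?thesis by (simp add: prob_space)
next
  case True
  have [measurable]: "j \<in> J \<Longrightarrow> Z j \<in> borel_measurable M" for j
    using assms(1) by (simp add: indep_vars_def)
  have "(CLINT \<omega>|M. iexp (\<Sum>j\<in>J. c j * Z j \<omega>)) = char (distr M borel (\<lambda>\<omega>. \<Sum>j\<in>J. c j * Z j \<omega>)) 1"
    by (simp add: char_def integral_distr)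
  also have "\<dots> = (\<Prod>j\<in>J. char (distr M borel (\<lambda>\<omega>. c j * Z j \<omega>)) 1)"
    by (intro char_distr_sum indep_vars_compose2[OF assms(1)]) auto
  also have "\<dots> = (\<Prod>j\<in>J. char (distr M borel (Z j)) (c j))"
    by (intro prod.cong refl) (simp add: char_def integral_distr)
  also have "\<dots> = (\<Prod>j\<in>J. of_real (exp (- (c j)\<^sup>2 / 2)))"
    by (intro prod.cong refl) (simp add: Z char_std_normal_distribution)
  also have "\<dots> = of_real (exp (\<Sum>j\<in>J. - (c j)\<^sup>2 / 2))"
    using True by (simp add: exp_sum)
  also have "(\<Sum>j\<in>J. - (c j)\<^sup>2 / 2) = - (\<Sum>j\<in>J. (c j)\<^sup>2) / 2"
    by (simp add: sum_negf sum_divide_distrib)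
  finally show ?thesis .
qed

text \<open>
  The limit law is written as the image of the standard normal law under a dilation, rather than
  through a normal density, so that the degenerate case \<open>L2_set c J = 0\<close> is included.
\<close>

lemma (in prob_space) gaussian_lincomb_law:
  assumes indep: "indep_vars (\<lambda>_. borel) Z J"
    and Z: "\<And>j. j \<in> J \<Longrightarrow> distr M borel (Z j) = std_normal_distribution"
  shows "distr M borel (\<lambda>\<omega>. \<Sum>j\<in>J. c j * Z j \<omega>) = distr std_normal_distribution borel (\<lambda>x. L2_set c J * x)"
proof -
  have [measurable]: "j \<in> J \<Longrightarrow> Z j \<in> borel_measurable M" for j
    using indep by (simp add: indep_vars_def)
  interpret N: real_distribution std_normal_distribution by (rule real_dist_normal_dist)
  show ?thesis
  proof (rule Levy_uniqueness)
    show "real_distribution (distr M borel (\<lambda>\<omega>. \<Sum>j\<in>J. c j * Z j \<omega>))"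
      by (intro real_distribution_distr) measurable
    show "real_distribution (distr std_normal_distribution borel (\<lambda>x. L2_set c J * x))"
      by (intro N.real_distribution_distr) measurable
    show "char (distr M borel (\<lambda>\<omega>. \<Sum>j\<in>J. c j * Z j \<omega>)) = char (distr std_normal_distribution borel (\<lambda>x. L2_set c J * x))"
    proof
      fix t
      have "char (distr M borel (\<lambda>\<omega>. \<Sum>j\<in>J. c j * Z j \<omega>)) t = (CLINT \<omega>|M. iexp (\<Sum>j\<in>J. (t * c j) * Z j \<omega>))"
        by (simp add: char_def integral_distr sum_distrib_left mult.assoc)
      also have "\<dots> = of_real (exp (- (\<Sum>j\<in>J. (t * c j)\<^sup>2) / 2))"
        using indep Z by (rule char_gaussian_lincomb)
      also have "(\<Sum>j\<in>J. (t * c j)\<^sup>2) = (t * L2_set c J)\<^sup>2"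
        by (simp add: power_mult_distrib L2_set_def sum_nonneg sum_distrib_left)
      also have "of_real (exp (- (t * L2_set c J)\<^sup>2 / 2)) = char std_normal_distribution (t * L2_set c J)"
        by (simp add: char_std_normal_distribution)
      also have "\<dots> = char (distr std_normal_distribution borel (\<lambda>x. L2_set c J * x)) t"
        by (simp add: char_def integral_distr mult.assoc)
      finally show "char (distr M borel (\<lambda>\<omega>. \<Sum>j\<in>J. c j * Z j \<omega>)) t = char (distr std_normal_distribution borel (\<lambda>x. L2_set c J * x)) t" .
    qed
  qed
qed

lemma (in prob_space) gaussian_lincomb_even_moment:
  assumes indep: "indep_vars (\<lambda>_. borel) Z J"
    and Z: "\<And>j. j \<in> J \<Longrightarrow> distr M borel (Z j) = std_normal_distribution"
  shows "integrable M (\<lambda>\<omega>. (\<Sum>j\<in>J. c j * Z j \<omega>) ^ (2 * k))"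
    and "expectation (\<lambda>\<omega>. (\<Sum>j\<in>J. c j * Z j \<omega>) ^ (2 * k))
      = fact (2 * k) / (2 ^ k * fact k) * (L2_set c J) ^ (2 * k)"
proof -
  have [measurable]: "j \<in> J \<Longrightarrow> Z j \<in> borel_measurable M" for j
    using indep by (simp add: indep_vars_def)
  note law = gaussian_lincomb_law[OF indep Z, of c]
  have int: "integrable std_normal_distribution (\<lambda>x. (L2_set c J * x) ^ (2 * k))"
    unfolding power_mult_distrib by (intro integrable_mult_right integrable_std_normal_distribution_moment)
  have "integrable (distr std_normal_distribution borel (\<lambda>x. L2_set c J * x)) (\<lambda>x. x ^ (2 * k))"
    using int by (subst integrable_distr_eq) auto
  then have "integrable (distr M borel (\<lambda>\<omega>. \<Sum>j\<in>J. c j * Z j \<omega>)) (\<lambda>x. x ^ (2 * k))"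
    by (simp only: law)
  then show "integrable M (\<lambda>\<omega>. (\<Sum>j\<in>J. c j * Z j \<omega>) ^ (2 * k))"
    by (subst (asm) integrable_distr_eq) auto
  have "expectation (\<lambda>\<omega>. (\<Sum>j\<in>J. c j * Z j \<omega>) ^ (2 * k))
      = (LINT x|distr M borel (\<lambda>\<omega>. \<Sum>j\<in>J. c j * Z j \<omega>). x ^ (2 * k))"
    by (subst integral_distr) auto
  also have "\<dots> = (LINT x|distr std_normal_distribution borel (\<lambda>x. L2_set c J * x). x ^ (2 * k))"
    by (simp only: law)
  also have "\<dots> = (LINT x|std_normal_distribution. (L2_set c J * x) ^ (2 * k))"
    by (subst integral_distr) auto
  also have "\<dots> = (L2_set c J) ^ (2 * k) * (LINT x|std_normal_distribution. x ^ (2 * k))"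
    unfolding power_mult_distrib by simp
  also have "\<dots> = fact (2 * k) / (2 ^ k * fact k) * (L2_set c J) ^ (2 * k)"
    unfolding std_normal_distribution_even_moments(1) by (rule mult.commute)
  finally show "expectation (\<lambda>\<omega>. (\<Sum>j\<in>J. c j * Z j \<omega>) ^ (2 * k))
      = fact (2 * k) / (2 ^ k * fact k) * (L2_set c J) ^ (2 * k)" .
qed

text \<open>
  Rotation invariance of the standard Gaussian law. The joint characteristic function at \<open>t\<close> is
  that of a linear combination of the \<open>Z j\<close> with coefficient vector \<open>\<Sum>m\<in>I. t m * u m\<close>, whose
  length is that of \<open>t\<close> by orthonormality; so it factorises and Kac's theorem applies.
\<close>

lemma (in prob_space) orthonormal_gaussian_joint_law:
  fixes u :: "'i \<Rightarrow> 'j \<Rightarrow> real"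
  assumes "finite I" and indep: "indep_vars (\<lambda>_. borel) Z J"
    and Z: "\<And>j. j \<in> J \<Longrightarrow> distr M borel (Z j) = std_normal_distribution"
    and orth: "\<And>m l. m \<in> I \<Longrightarrow> l \<in> I \<Longrightarrow> (\<Sum>j\<in>J. u m j * u l j) = (if m = l then 1 else 0)"
  shows "distr M (\<Pi>\<^sub>M m\<in>I. borel) (\<lambda>\<omega>. \<lambda>m\<in>I. \<Sum>j\<in>J. u m j * Z j \<omega>) = (\<Pi>\<^sub>M m\<in>I. std_normal_distribution)"
proof (rule joint_law_if_char_factorises)
  have [measurable]: "j \<in> J \<Longrightarrow> Z j \<in> borel_measurable M" for j
    using indep by (simp add: indep_vars_def)
  show "(\<lambda>\<omega>. \<Sum>j\<in>J. u m j * Z j \<omega>) \<in> borel_measurable M" for m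
    by measurable
  fix t :: "'i \<Rightarrow> real"
  have "(\<Sum>m\<in>I. t m * (\<Sum>j\<in>J. u m j * Z j \<omega>)) = (\<Sum>j\<in>J. (\<Sum>m\<in>I. t m * u m j) * Z j \<omega>)" for \<omega>
    by (simp add: sum_distrib_left sum_distrib_right sum.swap[of _ J I] mult.assoc)
  then have "(CLINT \<omega>|M. iexp (\<Sum>m\<in>I. t m * (\<Sum>j\<in>J. u m j * Z j \<omega>)))
      = of_real (exp (- (\<Sum>j\<in>J. (\<Sum>m\<in>I. t m * u m j)\<^sup>2) / 2))"
    using char_gaussian_lincomb[OF indep Z] by (simp only:)
  also have "(\<Sum>j\<in>J. (\<Sum>m\<in>I. t m * u m j)\<^sup>2) = (\<Sum>m\<in>I. \<Sum>l\<in>I. t m * t l * (\<Sum>j\<in>J. u m j * u l j))"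
  proof -
    have "(\<Sum>j\<in>J. (\<Sum>m\<in>I. t m * u m j)\<^sup>2) = (\<Sum>j\<in>J. \<Sum>m\<in>I. \<Sum>l\<in>I. t m * t l * (u m j * u l j))"
      by (simp add: power2_eq_square sum_product mult_ac)
    also have "\<dots> = (\<Sum>m\<in>I. \<Sum>l\<in>I. \<Sum>j\<in>J. t m * t l * (u m j * u l j))"
      by (simp add: sum.swap[of _ J])
    finally show ?thesis by (simp add: sum_distrib_left)
  qed
  also have "\<dots> = (\<Sum>m\<in>I. \<Sum>l\<in>I. if m = l then (t m)\<^sup>2 else 0)"
    using orth by (intro sum.cong refl) (auto simp: power2_eq_square)
  also have "\<dots> = (\<Sum>m\<in>I. (t m)\<^sup>2)"
    using \<open>finite I\<close> by simp
  also have "complex_of_real (exp (- (\<Sum>m\<in>I. (t m)\<^sup>2) / 2)) = (\<Prod>m\<in>I. char std_normal_distribution (t m))"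
  proof -
    have "- (\<Sum>m\<in>I. (t m)\<^sup>2) / 2 = (\<Sum>m\<in>I. - (t m)\<^sup>2 / 2)"
      by (simp add: sum_negf sum_divide_distrib)
    then show ?thesis using \<open>finite I\<close> by (simp add: exp_sum char_std_normal_distribution)
  qed
  finally show "(CLINT \<omega>|M. iexp (\<Sum>m\<in>I. t m * (\<Sum>j\<in>J. u m j * Z j \<omega>))) = (\<Prod>m\<in>I. char std_normal_distribution (t m))" .
qed (use \<open>finite I\<close> real_dist_normal_dist in auto)

text \<open>
  The factors of \<open>y\<^sup>2 - x\<^sup>2 = (y - x) * (y + x)\<close> are separated by the inequality between arithmetic
  and geometric means. The weight \<open>k\<close> is free; it is later chosen so that both terms are of the
  same size although \<open>y - x\<close> is small and \<open>y + x\<close> is not.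
\<close>

lemma square_diff_squares_le:
  fixes a b x y k :: real
  assumes "0 < k"
  shows "(a * y\<^sup>2 - b * x\<^sup>2)\<^sup>2 \<le> a\<^sup>2 * ((y - x)^4 / k\<^sup>2 + k\<^sup>2 * (y + x)^4) + 2 * (a - b)\<^sup>2 * x^4"
proof -
  have two: "(p + r)\<^sup>2 \<le> 2 * p\<^sup>2 + 2 * r\<^sup>2" for p r :: real
    using zero_le_power2[of "p - r"] by (simp add: power2_eq_square algebra_simps)
  have "y\<^sup>2 - x\<^sup>2 = (y - x) * (y + x)"
    by (simp add: power2_eq_square algebra_simps)
  then have "2 * (y\<^sup>2 - x\<^sup>2)\<^sup>2 = 2 * (((y - x)\<^sup>2 / k) * (k * (y + x)\<^sup>2))"
    using assms by (simp add: power_mult_distrib)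
  also have "\<dots> \<le> ((y - x)\<^sup>2 / k)\<^sup>2 + (k * (y + x)\<^sup>2)\<^sup>2"
    using sum_squares_bound[of "(y - x)\<^sup>2 / k" "k * (y + x)\<^sup>2"] by (simp only: mult.assoc)
  also have "\<dots> = (y - x)^4 / k\<^sup>2 + k\<^sup>2 * (y + x)^4"
    by (simp add: power_divide power_mult_distrib flip: power_mult)
  finally have amgm: "2 * (y\<^sup>2 - x\<^sup>2)\<^sup>2 \<le> (y - x)^4 / k\<^sup>2 + k\<^sup>2 * (y + x)^4" .
  have "(a * y\<^sup>2 - b * x\<^sup>2)\<^sup>2 = (a * (y\<^sup>2 - x\<^sup>2) + (a - b) * x\<^sup>2)\<^sup>2"
    by (simp add: algebra_simps)
  also have "\<dots> \<le> 2 * (a * (y\<^sup>2 - x\<^sup>2))\<^sup>2 + 2 * ((a - b) * x\<^sup>2)\<^sup>2"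
    by (rule two)
  also have "\<dots> = a\<^sup>2 * (2 * (y\<^sup>2 - x\<^sup>2)\<^sup>2) + 2 * (a - b)\<^sup>2 * x^4"
    by (simp add: power_mult_distrib flip: power_mult)
  also have "\<dots> \<le> a\<^sup>2 * ((y - x)^4 / k\<^sup>2 + k\<^sup>2 * (y + x)^4) + 2 * (a - b)\<^sup>2 * x^4"
    using amgm by (intro add_mono mult_left_mono) auto
  finally show ?thesis .
qed

text \<open>
  Two quadratic forms in the same Gaussian vector are close in \<open>L\<^sup>2\<close> if their coefficients and the
  vectors that define them are close: the differences and sums of the linear forms are Gaussian
  with standard deviations at most \<open>\<delta>\<close> and \<open>2 + \<delta>\<close>, and a centred Gaussian with variance \<open>\<sigma>\<^sup>2\<close> has
  fourth moment \<open>3 * \<sigma>\<^sup>4\<close>.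
\<close>

lemma (in prob_space) quadratic_form_L2_distance:
  fixes u v :: "'i \<Rightarrow> 'j \<Rightarrow> real" and a b :: "'i \<Rightarrow> real"
  assumes "finite I" and indep: "indep_vars (\<lambda>_. borel) Z J"
    and Z: "\<And>j. j \<in> J \<Longrightarrow> distr M borel (Z j) = std_normal_distribution"
    and unit: "\<And>m. m \<in> I \<Longrightarrow> L2_set (u m) J = 1"
    and near: "\<And>m. m \<in> I \<Longrightarrow> L2_set (\<lambda>j. v m j - u m j) J \<le> \<delta>" and \<delta>: "0 < \<delta>"
  defines "T \<equiv> \<lambda>\<omega>. \<Sum>m\<in>I. a m * (\<Sum>j\<in>J. v m j * Z j \<omega>)\<^sup>2 - b m * (\<Sum>j\<in>J. u m j * Z j \<omega>)\<^sup>2"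
  shows "integrable M (\<lambda>\<omega>. (T \<omega>)\<^sup>2)"
    and "expectation (\<lambda>\<omega>. (T \<omega>)\<^sup>2)
      \<le> 6 * card I * (\<Sum>m\<in>I. (a m)\<^sup>2 * (\<delta> * (2 + \<delta>))\<^sup>2 + (a m - b m)\<^sup>2)"
proof -
  define L where "L c \<omega> = (\<Sum>j\<in>J. c j * Z j \<omega>)" for c :: "'j \<Rightarrow> real" and \<omega>
  have [measurable]: "j \<in> J \<Longrightarrow> Z j \<in> borel_measurable M" for j
    using indep by (simp add: indep_vars_def)
  have [measurable]: "L c \<in> borel_measurable M" for c unfolding L_def by measurable
  have int4: "integrable M (\<lambda>\<omega>. (L c \<omega>)^4)" and mom4: "expectation (\<lambda>\<omega>. (L c \<omega>)^4) = 3 * (L2_set c J)^4" for c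
    using gaussian_lincomb_even_moment[OF indep Z, of c 2]
    by (simp_all add: L_def fact_numeral)
  have L_diff: "L (v m) \<omega> - L (u m) \<omega> = L (\<lambda>j. v m j - u m j) \<omega>"
    and L_add: "L (v m) \<omega> + L (u m) \<omega> = L (\<lambda>j. v m j + u m j) \<omega>" for m \<omega>
    by (simp_all add: L_def left_diff_distrib sum_subtractf distrib_right sum.distrib)
  (* the ratio of the bounds on the two standard deviations *)
  define k where "k = \<delta> / (2 + \<delta>)"
  have k: "0 < k" using \<delta> by (simp add: k_def)
  define g where "g m \<omega> = (a m)\<^sup>2 * ((L (\<lambda>j. v m j - u m j) \<omega>)^4 / k\<^sup>2 + k\<^sup>2 * (L (\<lambda>j. v m j + u m j) \<omega>)^4)
      + 2 * (a m - b m)\<^sup>2 * (L (u m) \<omega>)^4" for m \<omega>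
  have T_def': "T \<omega> = (\<Sum>m\<in>I. a m * (L (v m) \<omega>)\<^sup>2 - b m * (L (u m) \<omega>)\<^sup>2)" for \<omega>
    by (simp add: T_def L_def)
  have [measurable]: "T \<in> borel_measurable M" unfolding T_def' by measurable
  have T_le: "(T \<omega>)\<^sup>2 \<le> (\<Sum>m\<in>I. g m \<omega>) * card I" for \<omega>
  proof -
    have "(T \<omega>)\<^sup>2 \<le> (\<Sum>m\<in>I. (a m * (L (v m) \<omega>)\<^sup>2 - b m * (L (u m) \<omega>)\<^sup>2)\<^sup>2) * card I"
      unfolding T_def' by (rule sum_squared_le_sum_of_squares)
    also have "\<dots> \<le> (\<Sum>m\<in>I. g m \<omega>) * card I"
      unfolding g_def L_diff[symmetric] L_add[symmetric]
      by (intro mult_right_mono sum_mono square_diff_squares_le k) auto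
    finally show ?thesis .
  qed
  have int_g: "integrable M (g m)" for m
    unfolding g_def using int4 by simp
  show int: "integrable M (\<lambda>\<omega>. (T \<omega>)\<^sup>2)"
  proof (rule Bochner_Integration.integrable_bound)
    show "integrable M (\<lambda>\<omega>. (\<Sum>m\<in>I. g m \<omega>) * card I)"
      using int_g by simp
    show "AE \<omega> in M. norm ((T \<omega>)\<^sup>2) \<le> norm ((\<Sum>m\<in>I. g m \<omega>) * card I)"
      using T_le by (intro AE_I2) (simp add: order_trans[OF _ abs_ge_self])
  qed simp
  have Eg: "expectation (g m) \<le> 6 * ((a m)\<^sup>2 * (\<delta> * (2 + \<delta>))\<^sup>2 + (a m - b m)\<^sup>2)" if m: "m \<in> I" for m
  proof -
    have d: "L2_set (\<lambda>j. v m j - u m j) J \<le> \<delta>" by (rule near[OF m])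
    have s: "L2_set (\<lambda>j. v m j + u m j) J \<le> 2 + \<delta>"
      using L2_set_triangle_ineq[of "\<lambda>j. v m j - u m j" "\<lambda>j. 2 * u m j" J] d unit[OF m]
      by (simp add: L2_set_scale add.commute[of "v m _"])
    have "expectation (g m) = (a m)\<^sup>2 * (3 * (L2_set (\<lambda>j. v m j - u m j) J)^4 / k\<^sup>2
        + k\<^sup>2 * (3 * (L2_set (\<lambda>j. v m j + u m j) J)^4)) + 2 * (a m - b m)\<^sup>2 * 3"
      unfolding g_def using int4 by (simp add: mom4 unit[OF m])
    also have "\<dots> \<le> (a m)\<^sup>2 * (3 * \<delta>^4 / k\<^sup>2 + k\<^sup>2 * (3 * (2 + \<delta>)^4)) + 2 * (a m - b m)\<^sup>2 * 3"
      using d s by (intro add_mono mult_left_mono divide_right_mono power_mono order_refl) auto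
    also have "3 * \<delta>^4 / k\<^sup>2 + k\<^sup>2 * (3 * (2 + \<delta>)^4) = 6 * (\<delta> * (2 + \<delta>))\<^sup>2"
    proof -
      have "3 * \<delta>^4 / (\<delta> / s)\<^sup>2 + (\<delta> / s)\<^sup>2 * (3 * s^4) = 6 * (\<delta> * s)\<^sup>2" if "0 < s" for s
        using \<delta> that by (simp add: power_divide power_mult_distrib power2_eq_square power4_eq_xxxx)
      then show ?thesis using \<delta> by (simp add: k_def)
    qed
    finally show ?thesis by (simp add: algebra_simps)
  qed
  have "expectation (\<lambda>\<omega>. (T \<omega>)\<^sup>2) \<le> expectation (\<lambda>\<omega>. (\<Sum>m\<in>I. g m \<omega>) * card I)"
    using int_g int T_le by (intro integral_mono) auto
  also have "\<dots> = (\<Sum>m\<in>I. expectation (g m)) * card I"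
    using int_g by simp
  also have "\<dots> \<le> (\<Sum>m\<in>I. 6 * ((a m)\<^sup>2 * (\<delta> * (2 + \<delta>))\<^sup>2 + (a m - b m)\<^sup>2)) * card I"
    by (intro mult_right_mono sum_mono Eg) auto
  finally show "expectation (\<lambda>\<omega>. (T \<omega>)\<^sup>2)
      \<le> 6 * card I * (\<Sum>m\<in>I. (a m)\<^sup>2 * (\<delta> * (2 + \<delta>))\<^sup>2 + (a m - b m)\<^sup>2)"
    unfolding sum_distrib_left[symmetric] by (simp only: mult_ac)
qed

text \<open>Two random variables on one probability space are a coupling of their laws.\<close>

lemma (in prob_space) W2_le_L2_distance:
  fixes X Y :: "'a \<Rightarrow> real"
  assumes [measurable]: "X \<in> borel_measurable M" "Y \<in> borel_measurable M"
    and int: "integrable M (\<lambda>\<omega>. (X \<omega> - Y \<omega>)\<^sup>2)"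
    and B: "expectation (\<lambda>\<omega>. (X \<omega> - Y \<omega>)\<^sup>2) \<le> B\<^sup>2" "0 \<le> B"
  shows "W2 (distr M borel X) (distr M borel Y) \<le> ennreal B"
proof -
  define \<gamma> where "\<gamma> = distr M (borel :: (real \<times> real) measure) (\<lambda>\<omega>. (X \<omega>, Y \<omega>))"
  have "\<gamma> \<in> couplings (distr M borel X) (distr M borel Y)"
  proof -
    have [measurable]: "fst \<in> (borel :: (real \<times> real) measure) \<rightarrow>\<^sub>M borel"
      "snd \<in> (borel :: (real \<times> real) measure) \<rightarrow>\<^sub>M borel"
      by (auto intro!: borel_measurable_continuous_onI continuous_intros)
    show ?thesis
      unfolding couplings_def \<gamma>_def by (auto intro!: prob_space_distr simp: distr_distr comp_def)
  qed
  then have "W2_squared (distr M borel X) (distr M borel Y) \<le> (\<integral>\<^sup>+ (x, y). ennreal (\<bar>x - y\<bar>\<^sup>2) \<partial>\<gamma>)"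
    unfolding W2_squared_def by (rule INF_lower)
  also have "\<dots> = (\<integral>\<^sup>+ \<omega>. ennreal ((X \<omega> - Y \<omega>)\<^sup>2) \<partial>M)"
  proof -
    have "(\<lambda>(x::real, y::real). ennreal (\<bar>x - y\<bar>\<^sup>2)) \<in> borel_measurable borel"
      unfolding borel_prod[symmetric] by measurable
    then show ?thesis unfolding \<gamma>_def by (subst nn_integral_distr) auto
  qed
  also have "\<dots> = ennreal (expectation (\<lambda>\<omega>. (X \<omega> - Y \<omega>)\<^sup>2))"
    using int by (intro nn_integral_eq_integral) auto
  also have "\<dots> \<le> ennreal (B\<^sup>2)"
    using B by (intro ennreal_leI)
  finally have le: "W2_squared (distr M borel X) (distr M borel Y) \<le> ennreal (B\<^sup>2)" .
  then have "W2_squared (distr M borel X) (distr M borel Y) \<noteq> \<top>"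
    by (auto simp: top_unique)
  moreover have "enn2real (W2_squared (distr M borel X) (distr M borel Y)) \<le> B\<^sup>2"
    using le by (rule enn2real_leI[OF zero_le_power2])
  then have "sqrt (enn2real (W2_squared (distr M borel X) (distr M borel Y))) \<le> B"
    using \<open>0 \<le> B\<close> by (intro real_le_lsqrt)
  ultimately show ?thesis
    unfolding W2_def by (simp add: ennreal_leI)
qed

section \<open>The sampled eigenfunctions\<close>

text \<open>
  With the factor \<open>1 / sqrt n\<close> the inner product of two sampled functions is the Riemann sum of the
  integral of their product.
\<close>

definition sample :: "(nat \<Rightarrow> real \<Rightarrow> real) \<Rightarrow> nat \<Rightarrow> nat \<Rightarrow> nat \<Rightarrow> real" where
  "sample e n m i = e m (real i / real n) / sqrt (real n)"

text \<open>
  The Gram matrix of the sampled functions consists of Riemann sums of Hoelder functions whose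
  integrals are the entries of the identity matrix.
\<close>

lemma sample_gram_near_identity:
  assumes "finite I" and orth: "orthonormal_L2_01 I e" and "0 < \<alpha>"
    and holder: "\<And>m. m \<in> I \<Longrightarrow> holder_on \<alpha> {0..1} (e m)"
  shows "\<exists>C>0. \<forall>n\<ge>1. \<forall>m\<in>I. \<forall>l\<in>I.
    \<bar>(\<Sum>i=1..n. sample e n m i * sample e n l i) - (if m = l then 1 else 0)\<bar> \<le> C * real n powr - \<alpha>"
proof -
  define G where "G n m l = (\<Sum>i=1..n. sample e n m i * sample e n l i)" for n m l
  have G: "G n m l = 1 / real n * (\<Sum>i=1..n. e m (real i / real n) * e l (real i / real n))" for n m l
    by (simp add: G_def sample_def sum_divide_distrib)
  have "\<exists>C\<ge>0. \<forall>n\<ge>1. \<bar>G n m l - (if m = l then 1 else 0)\<bar> \<le> C * real n powr - \<alpha>" if "m \<in> I" "l \<in> I" for m l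
    using holder_riemann_sum_error[OF holder_on_mult[OF holder[OF that(1)] holder[OF that(2)] \<open>0 < \<alpha>\<close> compact_Icc] \<open>0 < \<alpha>\<close>]
      orth that unfolding G orthonormal_L2_01_def by simp
  then obtain c where c: "\<And>m l. m \<in> I \<Longrightarrow> l \<in> I \<Longrightarrow> 0 \<le> c m l"
    "\<And>m l n. m \<in> I \<Longrightarrow> l \<in> I \<Longrightarrow> 1 \<le> n \<Longrightarrow> \<bar>G n m l - (if m = l then 1 else 0)\<bar> \<le> c m l * real n powr - \<alpha>"
    by metis
  define C where "C = 1 + (\<Sum>m\<in>I. \<Sum>l\<in>I. c m l)"
  have le: "c m l \<le> C" if "m \<in> I" "l \<in> I" for m l
  proof -
    have "c m l \<le> (\<Sum>l\<in>I. c m l)"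
      using that c(1) \<open>finite I\<close> by (intro member_le_sum) auto
    also have "\<dots> \<le> (\<Sum>m\<in>I. \<Sum>l\<in>I. c m l)"
      using that c(1) \<open>finite I\<close> by (intro member_le_sum[of m I "\<lambda>m. \<Sum>l\<in>I. c m l"] sum_nonneg) auto
    finally show ?thesis by (simp add: C_def)
  qed
  have "0 < C"
    unfolding C_def using c(1) by (intro add_pos_nonneg sum_nonneg) auto
  moreover have "\<bar>G n m l - (if m = l then 1 else 0)\<bar> \<le> C * real n powr - \<alpha>" if "m \<in> I" "l \<in> I" "1 \<le> n" for m l n
    by (rule order_trans[OF c(2)[OF that]]) (intro mult_right_mono le that, simp)
  ultimately show ?thesis unfolding G_def by blast
qed

text \<open>
  The coefficient matrix is a combination of the rank-one matrices of the sampled functions. Hence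
  its Frobenius norm is a function of their Gram matrix, and the quadratic form is a weighted sum of
  \<open>q\<close> squares of linear forms, whatever \<open>n\<close> is.
\<close>

lemma coef_eq_sample: "coef q lam e n i j = (\<Sum>m=1..q. lam m * sample e n m i * sample e n m j)"
  by (simp add: coef_def kernel_def sample_def sum_divide_distrib)

lemma sum_coef_squared:
  "(\<Sum>i=1..n. \<Sum>j=1..n. (coef q lam e n i j)\<^sup>2)
    = (\<Sum>m=1..q. \<Sum>l=1..q. lam m * lam l * (\<Sum>i=1..n. sample e n m i * sample e n l i)\<^sup>2)"
proof -
  define s where "s = sample e n"
  have "(\<Sum>i=1..n. \<Sum>j=1..n. (coef q lam e n i j)\<^sup>2)
      = (\<Sum>i=1..n. \<Sum>j=1..n. \<Sum>m=1..q. \<Sum>l=1..q. lam m * lam l * ((s m i * s l i) * (s m j * s l j)))"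
    by (simp add: coef_eq_sample s_def power2_eq_square sum_product mult_ac)
  also have "\<dots> = (\<Sum>m=1..q. \<Sum>l=1..q. \<Sum>i=1..n. \<Sum>j=1..n. lam m * lam l * ((s m i * s l i) * (s m j * s l j)))"
    by (simp add: sum.swap[of _ "{1..q}" "{1..n}"] del: One_nat_def)
  also have "\<dots> = (\<Sum>m=1..q. \<Sum>l=1..q. lam m * lam l * (\<Sum>i=1..n. s m i * s l i)\<^sup>2)"
    unfolding power2_eq_square sum_product by (simp only: sum_distrib_left)
  finally show ?thesis by (simp only: s_def)
qed

lemma sum_coef_squared_near:
  assumes near: "\<And>m l. m \<in> {1..q} \<Longrightarrow> l \<in> {1..q} \<Longrightarrow>
      \<bar>(\<Sum>i=1..n. sample e n m i * sample e n l i) - (if m = l then 1 else 0)\<bar> \<le> \<epsilon>"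
    and \<epsilon>: "0 \<le> \<epsilon>" "\<epsilon> \<le> 1"
  shows "\<bar>(\<Sum>i=1..n. \<Sum>j=1..n. (coef q lam e n i j)\<^sup>2) - (\<Sum>m=1..q. (lam m)\<^sup>2)\<bar>
    \<le> 3 * (\<Sum>m=1..q. \<bar>lam m\<bar>)\<^sup>2 * \<epsilon>"
proof -
  define G where "G m l = (\<Sum>i=1..n. sample e n m i * sample e n l i)" for m l
  define D :: "nat \<Rightarrow> nat \<Rightarrow> real" where "D m l = (if m = l then 1 else 0)" for m l
  have G: "\<bar>G m l - D m l\<bar> \<le> \<epsilon>" if "m \<in> {1..q}" "l \<in> {1..q}" for m l
    using near[OF that] by (simp add: G_def D_def)
  have sq: "\<bar>(G m l)\<^sup>2 - D m l\<bar> \<le> 3 * \<epsilon>" if "m \<in> {1..q}" "l \<in> {1..q}" for m l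
  proof -
    have "(D m l)\<^sup>2 = D m l" by (simp add: D_def)
    then have "(G m l)\<^sup>2 - D m l = (G m l - D m l) * (G m l + D m l)"
      by (simp add: power2_eq_square algebra_simps)
    then have "\<bar>(G m l)\<^sup>2 - D m l\<bar> = \<bar>G m l - D m l\<bar> * \<bar>G m l + D m l\<bar>"
      by (simp add: abs_mult)
    also have "\<dots> \<le> \<epsilon> * 3"
    proof (rule mult_mono)
      have "0 \<le> D m l" "D m l \<le> 1" by (auto simp: D_def)
      with G[OF that] \<epsilon> show "\<bar>G m l + D m l\<bar> \<le> 3" by linarith
    qed (use G[OF that] \<epsilon> in auto)
    finally show ?thesis by simp
  qed
  have "(\<Sum>m=1..q. (lam m)\<^sup>2) = (\<Sum>m=1..q. \<Sum>l=1..q. lam m * lam l * D m l)"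
    by (simp add: D_def power2_eq_square if_distrib cong: if_cong)
  then have "(\<Sum>i=1..n. \<Sum>j=1..n. (coef q lam e n i j)\<^sup>2) - (\<Sum>m=1..q. (lam m)\<^sup>2)
    = (\<Sum>m=1..q. \<Sum>l=1..q. lam m * lam l * ((G m l)\<^sup>2 - D m l))"
    unfolding sum_coef_squared by (simp add: G_def sum_subtractf right_diff_distrib)
  also have "\<bar>\<dots>\<bar> \<le> (\<Sum>m=1..q. \<Sum>l=1..q. \<bar>lam m * lam l * ((G m l)\<^sup>2 - D m l)\<bar>)"
    by (intro order_trans[OF sum_abs] sum_mono sum_abs)
  also have "\<dots> \<le> (\<Sum>m=1..q. \<Sum>l=1..q. \<bar>lam m\<bar> * \<bar>lam l\<bar> * (3 * \<epsilon>))"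
    using sq by (intro sum_mono) (auto simp: abs_mult intro!: mult_left_mono)
  also have "\<dots> = 3 * (\<Sum>m=1..q. \<bar>lam m\<bar>)\<^sup>2 * \<epsilon>"
    by (simp add: power2_eq_square sum_product sum_distrib_left sum_distrib_right mult_ac)
  finally show ?thesis .
qed

lemma inverse_sqrt_near:
  fixes s t :: real
  assumes "0 < t" and near: "\<bar>s - t\<bar> \<le> \<eta>" and \<eta>: "\<eta> \<le> 3 / 4 * t"
  shows "1 / sqrt s \<le> 2 / sqrt t" and "\<bar>1 / sqrt s - 1 / sqrt t\<bar> \<le> 2 * \<eta> / (t * sqrt t)"
proof -
  have "t / 4 \<le> s" using near \<eta> by linarith
  then have "sqrt (t / 4) \<le> sqrt s" by simp
  then have half: "sqrt t / 2 \<le> sqrt s" by (simp add: real_sqrt_divide)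
  have t: "0 < sqrt t" and s: "0 < sqrt s" "0 < s" using \<open>0 < t\<close> half \<open>t / 4 \<le> s\<close> by (auto intro: less_le_trans)
  show inv: "1 / sqrt s \<le> 2 / sqrt t"
    using half t s by (simp add: field_simps)
  have "(sqrt t - sqrt s) * (sqrt t + sqrt s) = t - s"
    using s \<open>0 < t\<close> by (simp add: algebra_simps)
  then have "sqrt t - sqrt s = (t - s) / (sqrt t + sqrt s)"
    using t s by (subst nonzero_eq_divide_eq) auto
  then have "\<bar>sqrt t - sqrt s\<bar> = \<bar>s - t\<bar> / (sqrt t + sqrt s)"
    using t s by (simp add: abs_divide abs_minus_commute[of t s])
  also have "\<dots> \<le> \<eta> / sqrt t"
    using t s near by (intro frac_le) auto
  finally have diff: "\<bar>sqrt t - sqrt s\<bar> \<le> \<eta> / sqrt t" .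
  have "1 / sqrt s - 1 / sqrt t = (sqrt t - sqrt s) * (1 / sqrt s) * (1 / sqrt t)"
    using t s by (simp add: field_simps)
  then have "\<bar>1 / sqrt s - 1 / sqrt t\<bar> = \<bar>sqrt t - sqrt s\<bar> * (1 / sqrt s) * (1 / sqrt t)"
    using t s by (simp add: abs_mult)
  also have "\<dots> \<le> (\<eta> / sqrt t) * (2 / sqrt t) * (1 / sqrt t)"
    using diff inv t s order_trans[OF abs_ge_zero near] by (intro mult_mono) auto
  also have "\<dots> = 2 * \<eta> / (t * sqrt t)"
    using \<open>0 < t\<close> by simp
  finally show "\<bar>1 / sqrt s - 1 / sqrt t\<bar> \<le> 2 * \<eta> / (t * sqrt t)" .
qed

lemma Q_n_eq_sample:
  "Q_n q lam e Z n \<omega> = (\<Sum>m=1..q. lam m / sqrt (\<Sum>k=1..n. \<Sum>l=1..n. (coef q lam e n k l)\<^sup>2)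
     * (\<Sum>i=1..n. sample e n m i * Z i \<omega>)\<^sup>2)"
proof -
  define \<sigma> where "\<sigma> = sqrt (\<Sum>k=1..n. \<Sum>l=1..n. (coef q lam e n k l)\<^sup>2)"
  define s where "s = sample e n"
  have "Q_n q lam e Z n \<omega> = (\<Sum>i=1..n. \<Sum>j=1..n. \<Sum>m=1..q. lam m / \<sigma> * ((s m i * Z i \<omega>) * (s m j * Z j \<omega>)))"
    unfolding Q_n_def coef_normalised_def \<sigma>_def[symmetric] unfolding coef_eq_sample s_def[symmetric]
    by (simp add: sum_divide_distrib sum_distrib_right sum_distrib_left mult_ac)
  also have "\<dots> = (\<Sum>m=1..q. \<Sum>i=1..n. \<Sum>j=1..n. lam m / \<sigma> * ((s m i * Z i \<omega>) * (s m j * Z j \<omega>)))"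
    by (simp add: sum.swap[of _ "{1..q}" "{1..n}"] del: One_nat_def)
  also have "\<dots> = (\<Sum>m=1..q. lam m / \<sigma> * (\<Sum>i=1..n. s m i * Z i \<omega>)\<^sup>2)"
    unfolding power2_eq_square sum_product by (simp only: sum_distrib_left)
  finally show ?thesis by (simp only: \<sigma>_def s_def)
qed

section \<open>The coupling and the rate\<close>

text \<open>
  The coupling. The linear forms \<open>W m\<close> with the orthonormal coefficient vectors \<open>u m\<close> are independent
  standard normal variables, so the sum \<open>Q'\<close> built from them has the law of \<open>Q_infinity\<close>; unlike
  \<open>Q_infinity\<close> itself, it is close to the centred form, because \<open>u m\<close> is close to the sampled
  function. The difference of the two variables is a centred quadratic form \<open>T - expectation T\<close>, and
  centring does not increase the second moment of \<open>T\<close>.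
\<close>

lemma (in prob_space) W2_Q_n_Q_infinity_le:
  fixes Z :: "nat \<Rightarrow> 'a \<Rightarrow> real"
  assumes indep: "indep_vars (\<lambda>_. borel) Z {1..}"
    and Z: "\<And>j. 1 \<le> j \<Longrightarrow> distr M borel (Z j) = std_normal_distribution"
    and orth: "\<And>m l. m \<in> {1..q} \<Longrightarrow> l \<in> {1..q} \<Longrightarrow>
      (\<Sum>i=1..n. u m i * u l i) = (if m = l then 1 else 0)"
    and near: "\<And>m. m \<in> {1..q} \<Longrightarrow> L2_set (\<lambda>i. sample e n m i - u m i) {1..n} \<le> \<delta>" and \<delta>: "0 < \<delta>"
    and B: "0 \<le> B" "6 * q * (\<Sum>m=1..q.
        (lam m / sqrt (\<Sum>k=1..n. \<Sum>l=1..n. (coef q lam e n k l)\<^sup>2))\<^sup>2 * (\<delta> * (2 + \<delta>))\<^sup>2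
        + (lam m / sqrt (\<Sum>k=1..n. \<Sum>l=1..n. (coef q lam e n k l)\<^sup>2) - lambda_normalised q lam m)\<^sup>2) \<le> B\<^sup>2"
  shows "W2 (distr M borel (Q_n_centred M q lam e Z n)) (distr M borel (Q_infinity q lam Z)) \<le> ennreal B"
proof -
  define a where "a m = lam m / sqrt (\<Sum>k=1..n. \<Sum>l=1..n. (coef q lam e n k l)\<^sup>2)" for m
  define b where "b = lambda_normalised q lam"
  define Y where "Y m \<omega> = (\<Sum>i=1..n. sample e n m i * Z i \<omega>)" for m \<omega>
  define W where "W m \<omega> = (\<Sum>i=1..n. u m i * Z i \<omega>)" for m \<omega>
  define R where "R \<omega> = (\<Sum>m=1..q. b m * (W m \<omega>)\<^sup>2)" for \<omega>
  define Q where "Q = Q_n q lam e Z n"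
  define T where "T \<omega> = (\<Sum>m=1..q. a m * (Y m \<omega>)\<^sup>2 - b m * (W m \<omega>)\<^sup>2)" for \<omega>
  define Q' where "Q' \<omega> = (\<Sum>m=1..q. b m * ((W m \<omega>)\<^sup>2 - 1))" for \<omega>
  have rv: "1 \<le> j \<Longrightarrow> Z j \<in> borel_measurable M" for j
    using indep by (simp add: indep_vars_def)
  have [measurable]: "Y m \<in> borel_measurable M" "W m \<in> borel_measurable M" for m
    unfolding Y_def W_def using rv by (auto intro!: borel_measurable_sum borel_measurable_times)
  have indep_n: "indep_vars (\<lambda>_. borel) Z {1..n}" and indep_q: "indep_vars (\<lambda>_. borel) Z {1..q}"
    using indep by (auto intro: indep_vars_subset)
  have Z_n: "\<And>j. j \<in> {1..n} \<Longrightarrow> distr M borel (Z j) = std_normal_distribution"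
    and Z_q: "\<And>j. j \<in> {1..q} \<Longrightarrow> distr M borel (Z j) = std_normal_distribution"
    using Z by auto
  have unit: "m \<in> {1..q} \<Longrightarrow> L2_set (u m) {1..n} = 1" for m
    using orth[of m m] by (simp add: L2_set_def power2_eq_square)
  have moment2: "integrable M (\<lambda>\<omega>. (\<Sum>i=1..n. c i * Z i \<omega>)\<^sup>2)"
      "expectation (\<lambda>\<omega>. (\<Sum>i=1..n. c i * Z i \<omega>)\<^sup>2) = (L2_set c {1..n})\<^sup>2" for c
    using gaussian_lincomb_even_moment[OF indep_n Z_n, of c 1] by simp_all
  have Q_eq: "Q \<omega> = (\<Sum>m=1..q. a m * (Y m \<omega>)\<^sup>2)" for \<omega>
    by (simp add: Q_def Q_n_eq_sample a_def Y_def)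
  have int_Q: "integrable M Q" and int_R: "integrable M R"
    unfolding Q_eq R_def Y_def W_def using moment2(1) by auto
  have ER: "expectation R = (\<Sum>m=1..q. b m)"
    unfolding R_def W_def using moment2(1) by (simp add: moment2(2) unit del: One_nat_def)
  have T_eq: "T \<omega> = Q \<omega> - R \<omega>" for \<omega>
    by (simp add: T_def Q_eq R_def sum_subtractf)
  have int_T: "integrable M T"
    unfolding T_eq using int_Q int_R by simp
  have int_T2: "integrable M (\<lambda>\<omega>. (T \<omega>)\<^sup>2)"
    and ET2: "expectation (\<lambda>\<omega>. (T \<omega>)\<^sup>2) \<le> B\<^sup>2"
  proof -
    show "integrable M (\<lambda>\<omega>. (T \<omega>)\<^sup>2)"
      unfolding T_def Y_def W_def
      by (rule quadratic_form_L2_distance(1)[where \<delta>=\<delta>, OF _ indep_n Z_n unit near \<delta>]) auto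
    have "expectation (\<lambda>\<omega>. (T \<omega>)\<^sup>2)
        \<le> 6 * card {1..q} * (\<Sum>m=1..q. (a m)\<^sup>2 * (\<delta> * (2 + \<delta>))\<^sup>2 + (a m - b m)\<^sup>2)"
      unfolding T_def Y_def W_def
      by (rule quadratic_form_L2_distance(2)[OF _ indep_n Z_n unit near \<delta>]) auto
    then show "expectation (\<lambda>\<omega>. (T \<omega>)\<^sup>2) \<le> B\<^sup>2"
      using B(2) by (simp add: a_def b_def)
  qed
  have centred: "Q_n_centred M q lam e Z n \<omega> - Q' \<omega> = T \<omega> - expectation T" for \<omega>
  proof -
    have "expectation T = expectation Q - expectation R"
      unfolding T_eq using int_Q int_R by simp
    moreover have "Q' \<omega> = R \<omega> - (\<Sum>m=1..q. b m)"
      by (simp add: Q'_def R_def right_diff_distrib sum_subtractf)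
    ultimately show ?thesis
      by (simp add: Q_n_centred_def Q_def[symmetric] T_eq ER)
  qed
  have law: "distr M borel Q' = distr M borel (Q_infinity q lam Z)"
  proof -
    define h :: "(nat \<Rightarrow> real) \<Rightarrow> real" where "h x = (\<Sum>m=1..q. b m * ((x m)\<^sup>2 - 1))" for x
    have [measurable]: "h \<in> borel_measurable (\<Pi>\<^sub>M m\<in>{1..q}. borel)"
      unfolding h_def by measurable
    have W_vec: "(\<lambda>\<omega>. \<lambda>m\<in>{1..q}. W m \<omega>) \<in> measurable M (\<Pi>\<^sub>M m\<in>{1..q}. borel)"
      and Z_vec: "(\<lambda>\<omega>. \<lambda>m\<in>{1..q}. Z m \<omega>) \<in> measurable M (\<Pi>\<^sub>M m\<in>{1..q}. borel)"
      using rv by (auto intro!: measurable_restrict)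
    have "distr M borel Q' = distr (distr M (\<Pi>\<^sub>M m\<in>{1..q}. borel) (\<lambda>\<omega>. \<lambda>m\<in>{1..q}. W m \<omega>)) borel h"
      using W_vec by (simp add: distr_distr comp_def h_def Q'_def[abs_def] del: One_nat_def)
    also have "distr M (\<Pi>\<^sub>M m\<in>{1..q}. borel) (\<lambda>\<omega>. \<lambda>m\<in>{1..q}. W m \<omega>) = (\<Pi>\<^sub>M m\<in>{1..q}. std_normal_distribution)"
      unfolding W_def using orth by (intro orthonormal_gaussian_joint_law[OF _ indep_n Z_n]) auto
    also have "\<dots> = distr M (\<Pi>\<^sub>M m\<in>{1..q}. borel) (\<lambda>\<omega>. \<lambda>m\<in>{1..q}. \<Sum>j=1..q. (if m = j then 1 else 0) * Z j \<omega>)"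
    proof (intro orthonormal_gaussian_joint_law[OF _ indep_q Z_q, symmetric])
      fix m l assume "m \<in> {1..q}" "l \<in> {1..q}"
      have "(\<Sum>j=1..q. (if m = j then 1 else 0) * (if l = j then 1 else 0 :: real))
        = (\<Sum>j=1..q. if j = m then (if m = l then 1 else 0) else 0)"
        by (intro sum.cong) auto
      then show "(\<Sum>j=1..q. (if m = j then 1 else 0) * (if l = j then 1 else 0 :: real)) = (if m = l then 1 else 0)"
        using \<open>m \<in> {1..q}\<close> by simp
    qed auto
    also have "(\<lambda>\<omega>. \<lambda>m\<in>{1..q}. \<Sum>j=1..q. (if m = j then 1 else 0) * Z j \<omega>) = (\<lambda>\<omega>. \<lambda>m\<in>{1..q}. Z m \<omega>)"
      by (intro ext) (auto simp: restrict_def if_distrib[of "\<lambda>x. x * _"] cong: if_cong)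
    also have "distr (distr M (\<Pi>\<^sub>M m\<in>{1..q}. borel) (\<lambda>\<omega>. \<lambda>m\<in>{1..q}. Z m \<omega>)) borel h = distr M borel (Q_infinity q lam Z)"
      using Z_vec by (simp add: distr_distr comp_def h_def Q_infinity_def[abs_def] b_def del: One_nat_def)
    finally show ?thesis .
  qed
  have "W2 (distr M borel (Q_n_centred M q lam e Z n)) (distr M borel Q') \<le> ennreal B"
  proof (rule W2_le_L2_distance)
    show "Q_n_centred M q lam e Z n \<in> borel_measurable M"
      unfolding Q_n_centred_def[abs_def] Q_def[symmetric] Q_eq by measurable
    show "Q' \<in> borel_measurable M" unfolding Q'_def by measurable
    show "integrable M (\<lambda>\<omega>. (Q_n_centred M q lam e Z n \<omega> - Q' \<omega>)\<^sup>2)"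
      unfolding centred power2_diff using int_T int_T2 by auto
    have "expectation (\<lambda>\<omega>. (Q_n_centred M q lam e Z n \<omega> - Q' \<omega>)\<^sup>2) = expectation (\<lambda>\<omega>. (T \<omega>)\<^sup>2) - (expectation T)\<^sup>2"
      unfolding centred by (rule variance_eq[OF int_T int_T2])
    then show "expectation (\<lambda>\<omega>. (Q_n_centred M q lam e Z n \<omega> - Q' \<omega>)\<^sup>2) \<le> B\<^sup>2"
      using ET2 zero_le_power2[of "expectation T"] by linarith
  qed (rule B(1))
  then show ?thesis unfolding law .
qed

theorem corollary3p2:
  fixes q :: nat
    and lam :: "nat \<Rightarrow> real"
    and e :: "nat \<Rightarrow> real \<Rightarrow> real"
    and \<alpha> :: real
    and M :: "'a measure"
    and Z :: "nat \<Rightarrow> 'a \<Rightarrow> real"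
  assumes "q \<ge> 1"
    and "inj_on lam {1..q}"
    and "\<forall>m\<in>{1..q}. lam m \<noteq> 0"
    and "inj_on e {1..q}"
    and "orthonormal_L2_01 {1..q} e"
    and "0 < \<alpha>" and "\<alpha> \<le> 1"
    and "\<forall>m\<in>{1..q}. holder_on \<alpha> {0..1} (e m)"
    and "prob_space M"
    and "prob_space.indep_vars M (\<lambda>_. borel) Z {1..}"
    and "\<forall>i\<ge>1. distributed M lborel (Z i) std_normal_density"
  shows "(\<forall>\<^sub>F n in sequentially.
      W2 (distr M borel (Q_n_centred M q lam e Z n)) (distr M borel (Q_infinity q lam Z)) < \<top>) \<and>
    (\<lambda>n. enn2real
      (W2 (distr M borel (Q_n_centred M q lam e Z n)) (distr M borel (Q_infinity q lam Z))))
      \<in> O(\<lambda>n. 1 / real n powr (\<alpha> / 2))"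
proof -
  interpret prob_space M by fact
  have Z_law: "distr M borel (Z j) = std_normal_distribution" if "1 \<le> j" for j
  proof -
    have "distr M borel (Z j) = distr M lborel (Z j)" by (intro distr_cong) auto
    then show ?thesis using assms(11) that by (simp add: distributed_distr_eq_density)
  qed
  have "\<exists>C>0. \<forall>n\<ge>1. \<forall>m\<in>{1..q}. \<forall>l\<in>{1..q}.
    \<bar>(\<Sum>i=1..n. sample e n m i * sample e n l i) - (if m = l then 1 else 0)\<bar> \<le> C * real n powr - \<alpha>"
    by (rule sample_gram_near_identity[OF _ assms(5,6)]) (use assms(8) in auto)
  then obtain C where C: "0 < C" and gram_near: "\<forall>n\<ge>1. \<forall>m\<in>{1..q}. \<forall>l\<in>{1..q}.
    \<bar>(\<Sum>i=1..n. sample e n m i * sample e n l i) - (if m = l then 1 else 0)\<bar> \<le> C * real n powr - \<alpha>"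
    by (elim exE conjE) (rule that)
  obtain K \<delta> where K: "0 < K" and \<delta>: "0 < \<delta>" and orthonormalise:
    "\<forall>\<epsilon> (J::nat set) v. 0 \<le> \<epsilon> \<longrightarrow> \<epsilon> \<le> \<delta> \<longrightarrow>
      (\<forall>m\<in>{1..q}. \<forall>l\<in>{1..q}. \<bar>(\<Sum>j\<in>J. v m j * v l j) - (if m = l then 1 else 0)\<bar> \<le> \<epsilon>) \<longrightarrow>
      (\<exists>u. (\<forall>m\<in>{1..q}. \<forall>l\<in>{1..q}. (\<Sum>j\<in>J. u m j * u l j) = (if m = l then 1 else 0 :: real)) \<and>
        (\<forall>m\<in>{1..q}. L2_set (\<lambda>j. v m j - u m j) J \<le> K * \<epsilon>))"
    using near_orthonormal_to_orthonormal[OF finite_atLeastAtMost[of 1 q]]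
    by (elim exE conjE) (rule that)
  define t where "t = (\<Sum>m=1..q. (lam m)\<^sup>2)"
  define L where "L = (\<Sum>m=1..q. \<bar>lam m\<bar>)\<^sup>2"
  have t: "0 < t"
    unfolding t_def using assms(1,3) by (intro sum_pos) auto
  have L: "0 \<le> L" by (simp add: L_def)
  define \<epsilon> where "\<epsilon> n = C * real n powr - \<alpha>" for n
  (* E * (\<epsilon> n)\<^sup>2 is the bound on the squared cost once K * \<epsilon> n \<le> 1 and the normalising
     constant of order n is at least half of its limit *)
  define E where "E = 6 * q * (\<Sum>m=1..q. (lam m)\<^sup>2 * ((6 * K / sqrt t)\<^sup>2 + (6 * L / (t * sqrt t))\<^sup>2))"
  have E: "0 \<le> E" unfolding E_def by (intro mult_nonneg_nonneg sum_nonneg) auto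
  have bound: "W2 (distr M borel (Q_n_centred M q lam e Z n)) (distr M borel (Q_infinity q lam Z)) \<le> ennreal (sqrt E * \<epsilon> n)"
    if n: "1 \<le> n" and small: "\<epsilon> n \<le> \<delta>" "\<epsilon> n \<le> 1" "K * \<epsilon> n \<le> 1" "3 * L * \<epsilon> n \<le> 3 / 4 * t" for n
  proof -
    define s where "s = (\<Sum>k=1..n. \<Sum>l=1..n. (coef q lam e n k l)\<^sup>2)"
    have \<epsilon>: "0 < \<epsilon> n" using C n by (simp add: \<epsilon>_def)
    have gram: "\<bar>(\<Sum>i=1..n. sample e n m i * sample e n l i) - (if m = l then 1 else 0)\<bar> \<le> \<epsilon> n"
      if "m \<in> {1..q}" "l \<in> {1..q}" for m l
      unfolding \<epsilon>_def using gram_near n that by blast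
    obtain u where u: "\<forall>m\<in>{1..q}. \<forall>l\<in>{1..q}. (\<Sum>i=1..n. u m i * u l i) = (if m = l then 1 else 0 :: real)"
      "\<forall>m\<in>{1..q}. L2_set (\<lambda>i. sample e n m i - u m i) {1..n} \<le> K * \<epsilon> n"
      using orthonormalise[THEN spec, of "\<epsilon> n", THEN spec, of "{1..n}", THEN spec, of "sample e n"]
        gram \<epsilon> small(1) by (elim impE exE conjE) (auto intro: less_imp_le)
    have "\<bar>s - t\<bar> \<le> 3 * L * \<epsilon> n"
      unfolding s_def t_def L_def using gram \<epsilon> small(2) by (intro sum_coef_squared_near) auto
    note inv = inverse_sqrt_near[OF t this small(4)]
    have s0: "0 \<le> s" unfolding s_def by (intro sum_nonneg) auto
    show ?thesis
    proof (rule W2_Q_n_Q_infinity_le[where u=u and \<delta>="K * \<epsilon> n"])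
      have term_le: "(lam m / sqrt s)\<^sup>2 * (K * \<epsilon> n * (2 + K * \<epsilon> n))\<^sup>2 + (lam m / sqrt s - lambda_normalised q lam m)\<^sup>2
        \<le> (lam m)\<^sup>2 * ((6 * K / sqrt t)\<^sup>2 + (6 * L / (t * sqrt t))\<^sup>2) * (\<epsilon> n)\<^sup>2" for m
      proof -
        have "(1 / sqrt s) * (K * \<epsilon> n * (2 + K * \<epsilon> n)) \<le> (2 / sqrt t) * (K * \<epsilon> n * 3)"
          using inv(1) small(3) K \<epsilon> s0 t by (intro mult_mono mult_nonneg_nonneg) auto
        then have 1: "((1 / sqrt s) * (K * \<epsilon> n * (2 + K * \<epsilon> n)))\<^sup>2 \<le> ((6 * K / sqrt t) * \<epsilon> n)\<^sup>2"
          using K \<epsilon> s0 by (intro power_mono) (auto simp: mult_ac)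
        have "\<bar>1 / sqrt s - 1 / sqrt t\<bar> \<le> (6 * L / (t * sqrt t)) * \<epsilon> n"
          using inv(2) by (simp add: mult_ac)
        then have 2: "(1 / sqrt s - 1 / sqrt t)\<^sup>2 \<le> ((6 * L / (t * sqrt t)) * \<epsilon> n)\<^sup>2"
          by (simp add: abs_le_square_iff[symmetric] abs_of_nonneg L t less_imp_le[OF \<epsilon>] less_imp_le[OF t])
        have "(lam m / sqrt s)\<^sup>2 * (K * \<epsilon> n * (2 + K * \<epsilon> n))\<^sup>2 + (lam m / sqrt s - lambda_normalised q lam m)\<^sup>2
          = (lam m)\<^sup>2 * (((1 / sqrt s) * (K * \<epsilon> n * (2 + K * \<epsilon> n)))\<^sup>2 + (1 / sqrt s - 1 / sqrt t)\<^sup>2)"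
        proof -
          have "lam m / sqrt s - lambda_normalised q lam m = lam m * (1 / sqrt s - 1 / sqrt t)"
            by (simp add: lambda_normalised_def t_def right_diff_distrib)
          moreover have "(l * a)\<^sup>2 * p\<^sup>2 + (l * d)\<^sup>2 = l\<^sup>2 * ((a * p)\<^sup>2 + d\<^sup>2)" for l a p d :: real
            by (simp add: power_mult_distrib distrib_left)
          from this[of "lam m" "1 / sqrt s"] have "(lam m / sqrt s)\<^sup>2 * p\<^sup>2 + (lam m * d)\<^sup>2
            = (lam m)\<^sup>2 * ((1 / sqrt s * p)\<^sup>2 + d\<^sup>2)" for p d by simp
          ultimately show ?thesis by (simp only:)
        qed
        also have "\<dots> \<le> (lam m)\<^sup>2 * (((6 * K / sqrt t) * \<epsilon> n)\<^sup>2 + ((6 * L / (t * sqrt t)) * \<epsilon> n)\<^sup>2)"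
          by (intro mult_left_mono add_mono 1 2) auto
        finally show ?thesis by (simp only: power_mult_distrib distrib_right distrib_left mult.assoc)
      qed
      have "6 * real q * (\<Sum>m=1..q. (lam m / sqrt s)\<^sup>2 * (K * \<epsilon> n * (2 + K * \<epsilon> n))\<^sup>2 + (lam m / sqrt s - lambda_normalised q lam m)\<^sup>2)
        \<le> 6 * real q * (\<Sum>m=1..q. (lam m)\<^sup>2 * ((6 * K / sqrt t)\<^sup>2 + (6 * L / (t * sqrt t))\<^sup>2) * (\<epsilon> n)\<^sup>2)"
        by (intro mult_left_mono sum_mono term_le) auto
      also have "\<dots> = (sqrt E * \<epsilon> n)\<^sup>2"
        using E by (simp add: power_mult_distrib E_def sum_distrib_right mult.assoc)
      finally show "6 * real q * (\<Sum>m=1..q.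
        (lam m / sqrt (\<Sum>k=1..n. \<Sum>l=1..n. (coef q lam e n k l)\<^sup>2))\<^sup>2 * (K * \<epsilon> n * (2 + K * \<epsilon> n))\<^sup>2
        + (lam m / sqrt (\<Sum>k=1..n. \<Sum>l=1..n. (coef q lam e n k l)\<^sup>2) - lambda_normalised q lam m)\<^sup>2) \<le> (sqrt E * \<epsilon> n)\<^sup>2"
        unfolding s_def .
    qed (use assms(10) Z_law u K \<epsilon> E in auto)
  qed
  have "(\<lambda>n. real n powr - \<alpha>) \<longlonglongrightarrow> 0"
    using \<open>0 < \<alpha>\<close> by (intro tendsto_neg_powr filterlim_real_sequentially) auto
  then have lim: "(\<lambda>n. c * \<epsilon> n) \<longlonglongrightarrow> 0" for c
    unfolding \<epsilon>_def by (intro tendsto_mult_right_zero)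
  have small: "\<forall>\<^sub>F n in sequentially. c * \<epsilon> n \<le> d" if "0 < d" for c d
    using order_tendstoD(2)[OF lim[of c] that] by (rule eventually_mono) simp
  have t': "0 < 3 / 4 * t" using t by simp
  have ev: "\<forall>\<^sub>F n in sequentially. 1 \<le> n \<and>
      W2 (distr M borel (Q_n_centred M q lam e Z n)) (distr M borel (Q_infinity q lam Z)) \<le> ennreal (sqrt E * \<epsilon> n)"
    using eventually_ge_at_top[of 1] small[OF \<delta>, of 1] small[OF zero_less_one, of 1]
      small[OF zero_less_one, of K] small[OF t', of "3 * L"]
    by eventually_elim (auto intro!: bound)
  show ?thesis
  proof
    show "\<forall>\<^sub>F n in sequentially. W2 (distr M borel (Q_n_centred M q lam e Z n)) (distr M borel (Q_infinity q lam Z)) < \<top>"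
      using ev by eventually_elim (auto intro: le_less_trans)
    show "(\<lambda>n. enn2real (W2 (distr M borel (Q_n_centred M q lam e Z n)) (distr M borel (Q_infinity q lam Z))))
      \<in> O(\<lambda>n. 1 / real n powr (\<alpha> / 2))"
    proof (rule bigoI)
      show "\<forall>\<^sub>F n in sequentially. norm (enn2real (W2 (distr M borel (Q_n_centred M q lam e Z n)) (distr M borel (Q_infinity q lam Z))))
        \<le> (sqrt E * C) * norm (1 / real n powr (\<alpha> / 2))"
        using ev
      proof eventually_elim
        case (elim n)
        have "0 \<le> sqrt E * \<epsilon> n" using E C by (simp add: \<epsilon>_def)
        then have "enn2real (W2 (distr M borel (Q_n_centred M q lam e Z n)) (distr M borel (Q_infinity q lam Z))) \<le> sqrt E * \<epsilon> n"
          using elim by (intro enn2real_leI) auto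
        also have "\<dots> = sqrt E * C * real n powr - \<alpha>"
          by (simp add: \<epsilon>_def)
        (* the coupling even has the rate \<alpha>; the rate \<alpha> / 2 is weaker *)
        also have "\<dots> \<le> sqrt E * C * real n powr - (\<alpha> / 2)"
          using elim E C \<open>0 < \<alpha>\<close> by (intro mult_left_mono powr_mono) auto
        finally show ?case by (simp add: powr_minus_divide)
      qed
    qed
  qed
qed

end
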